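(* Let $H$ be an abundant acyclic quiver with $|H|=3$ and reddening source sequence $\mathbf S$. Let $\bullet_4$ denote the quiver with a single vertex labeled $4$ (not a vertex of $H$), and let $A$ be a $1\times 3$ integer matrix all of whose entries are $\ge 2$. Then for any mutation sequence $\mathbf M$ of vertices of $H$ such that $\mathbf M^{-1}\mathbf S\mathbf M$ is reduced, the mutation cycle $4,\mathbf M^{-1}\mathbf S\mathbf M$ of the quiver $\bullet_4\stackrel{A}{\rightarrow}\mu_{\mathbf M}(H)$ is the unique simple mutation cycle in the mutation class of $\bullet_4\stackrel{A}{\rightarrow}\mu_{\mathbf M}(H)$.
   Context: A quiver is a finite directed graph with labeled vertices, multiple arrows allowed, with no loops and no directed $2$-cycles; equality means equality of labeled graphs. $b_{xy}$ is the number of arrows $x\to y$ minus the number of arrows $y\to x$. A quiver is abundant if $|b_{ij}|\ge 2$ for all distinct $i,j$, and acyclic if it has no oriented cycles. Mutation $\mu_i$: for each path $u\to i\to v$ add an arrow $u\to v$; reverse all arrows at $i$; delete a maximal collection of oriented $2$-cycles; $\mu_{\mathbf i}=\mu_{i_m}\circ\cdots\circ\mu_{i_1}$ for $\mathbf i=i_1,\dots,i_m$; $\mathbf i^{-1}=i_m,\dots,i_1$; juxtaposition/commas denote concatenation; a sequence is reduced if no two consecutive entries are equal. The mutation class of a quiver is the set of all quivers obtainable from it by mutation sequences. The framed quiver $\widehat Q$ adds a frozen vertex $i'$ and an arrow $i\to i'$ for each vertex $i$; mutations only at mutable vertices. A reddening sequence for $Q$ is a sequence such that every mutable vertex $j$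 of the resulting mutation of $\widehat Q$ satisfies $b_{ji'}\le0$ for all frozen $i'$. A source sequence of an acyclic quiver is a sequence $v_1,\dots,v_k$ such that any arrow $v_i\to v_j$ has $i<j$; a reddening source sequence is a source sequence that is also a reddening sequence. For quivers $T,H'$ on disjoint vertex sets and a nonnegative integer $|T|\times|H'|$ matrix $A=(a_{th})$, $T\stackrel{A}{\rightarrow}H'$ is the quiver containing $T$, $H'$ as full subquivers with exactly $a_{th}$ arrows $t\to h$ and no other arrows between them. A mutation cycle of $Q$ is a sequence $\mathbf i=i_1,\dots,i_m$ with no two consecutive entries equal and $\mu_{\mathbf i}(Q)=Q$ (a closed walk in the mutation graph); it is simple if the quivers $Q,\mu_{i_1}(Q),\dots,\mu_{i_{m-1}}\cdots\mu_{i_1}(Q)$ are pairwise distinct. *)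

theory Defs
  imports Main
begin

text \<open>
  A quiver is a labelled multigraph: a set of vertices and the number of arrows \<open>u \<rightarrow> v\<close> for
  each ordered pair of labels.  Well-formed quivers have no arrows outside their vertex set, so
  equality of records is equality of labelled quivers.
\<close>

record 'a quiver =
  verts :: "'a set"
  arrows :: "'a \<Rightarrow> 'a \<Rightarrow> nat"

definition is_quiver :: "'a quiver \<Rightarrow> bool" where
  "is_quiver Q \<longleftrightarrow>
     finite (verts Q) \<and>
     (\<forall>u v. arrows Q u v > 0 \<longrightarrow> u \<in> verts Q \<and> v \<in> verts Q) \<and>
     (\<forall>u. arrows Q u u = 0) \<and>
     (\<forall>u v. arrows Q u v = 0 \<or> arrows Q v u = 0)"

definition b_entry :: "'a quiver \<Rightarrow> 'a \<Rightarrow> 'a \<Rightarrow> int" where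
  "b_entry Q u v = int (arrows Q u v) - int (arrows Q v u)"

definition abundant :: "'a quiver \<Rightarrow> bool" where
  "abundant Q \<longleftrightarrow> (\<forall>i \<in> verts Q. \<forall>j \<in> verts Q. i \<noteq> j \<longrightarrow> \<bar>b_entry Q i j\<bar> \<ge> 2)"

definition acyclic_quiver :: "'a quiver \<Rightarrow> bool" where
  "acyclic_quiver Q \<longleftrightarrow> acyclic {(u, v). arrows Q u v > 0}"

text \<open>
  \<open>premutate i Q u v\<close> counts the arrows \<open>u \<rightarrow> v\<close> after an arrow has been added for each path
  \<open>u \<rightarrow> i \<rightarrow> v\<close> and the arrows at \<open>i\<close> have been reversed.  Deleting a maximal collection of
  oriented 2-cycles then is truncated subtraction.
\<close>

definition premutate :: "'a \<Rightarrow> 'a quiver \<Rightarrow> 'a \<Rightarrow> 'a \<Rightarrow> nat" where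
  "premutate i Q u v =
     (if u = i \<or> v = i then arrows Q v u
      else arrows Q u v + arrows Q u i * arrows Q i v)"

definition mutate :: "'a \<Rightarrow> 'a quiver \<Rightarrow> 'a quiver" where
  "mutate i Q =
     \<lparr>verts = verts Q, arrows = (\<lambda>u v. premutate i Q u v - premutate i Q v u)\<rparr>"

text \<open>The first entry of the list is mutated first.\<close>

definition mutate_seq :: "'a list \<Rightarrow> 'a quiver \<Rightarrow> 'a quiver" where
  "mutate_seq xs Q = fold mutate xs Q"

definition mutation_class :: "'a quiver \<Rightarrow> 'a quiver set" where
  "mutation_class Q = {mutate_seq xs Q | xs. set xs \<subseteq> verts Q}"

text \<open>In the framed quiver, \<open>Inl i\<close> is the mutable vertex \<open>i\<close> and \<open>Inr i\<close> its frozen copy \<open>i'\<close>.\<close>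

definition framed :: "'a quiver \<Rightarrow> ('a + 'a) quiver" where
  "framed Q =
     \<lparr>verts = Inl ` verts Q \<union> Inr ` verts Q,
      arrows = (\<lambda>x y. case (x, y) of
          (Inl u, Inl v) \<Rightarrow> arrows Q u v
        | (Inl u, Inr v) \<Rightarrow> (if u = v \<and> u \<in> verts Q then 1 else 0)
        | _ \<Rightarrow> 0)\<rparr>"

definition reddening_seq :: "'a quiver \<Rightarrow> 'a list \<Rightarrow> bool" where
  "reddening_seq Q xs \<longleftrightarrow>
     set xs \<subseteq> verts Q \<and>
     (\<forall>j \<in> verts Q. \<forall>i \<in> verts Q. b_entry (mutate_seq (map Inl xs) (framed Q)) (Inl j) (Inr i) \<le> 0)"

definition source_seq :: "'a quiver \<Rightarrow> 'a list \<Rightarrow> bool" where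
  "source_seq Q xs \<longleftrightarrow>
     acyclic_quiver Q \<and> set xs \<subseteq> verts Q \<and>
     (\<forall>i < length xs. \<forall>j < length xs. arrows Q (xs ! i) (xs ! j) > 0 \<longrightarrow> i < j)"

definition reddening_source_seq :: "'a quiver \<Rightarrow> 'a list \<Rightarrow> bool" where
  "reddening_source_seq Q xs \<longleftrightarrow> source_seq Q xs \<and> reddening_seq Q xs"

definition point_quiver :: "'a \<Rightarrow> 'a quiver" where
  "point_quiver x = \<lparr>verts = {x}, arrows = (\<lambda>_ _. 0)\<rparr>"

text \<open>
  \<open>quiver_join T A H\<close> is the quiver \<open>T \<rightarrow> H\<close> with \<open>A t h\<close> arrows \<open>t \<rightarrow> h\<close>; it is only meaningful for
  disjoint vertex sets, and only the entries of \<open>A\<close> in \<open>verts T \<times> verts H\<close> matter.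
\<close>

definition quiver_join :: "'a quiver \<Rightarrow> ('a \<Rightarrow> 'a \<Rightarrow> nat) \<Rightarrow> 'a quiver \<Rightarrow> 'a quiver" where
  "quiver_join T A H =
     \<lparr>verts = verts T \<union> verts H,
      arrows = (\<lambda>u v. arrows T u v + arrows H u v +
                       (if u \<in> verts T \<and> v \<in> verts H then A u v else 0))\<rparr>"

text \<open>\<^const>\<open>distinct_adj\<close> says that a sequence is reduced.  The trivial closed walk is excluded.\<close>

definition mutation_cycle :: "'a quiver \<Rightarrow> 'a list \<Rightarrow> bool" where
  "mutation_cycle Q xs \<longleftrightarrow>
     xs \<noteq> [] \<and> set xs \<subseteq> verts Q \<and> distinct_adj xs \<and> mutate_seq xs Q = Q"

definition simple_mutation_cycle :: "'a quiver \<Rightarrow> 'a list \<Rightarrow> bool" where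
  "simple_mutation_cycle Q xs \<longleftrightarrow>
     mutation_cycle Q xs \<and> distinct (map (\<lambda>k. mutate_seq (take k xs) Q) [0..<length xs])"

text \<open>
  A mutation cycle is a closed walk in the mutation graph, presented by a base point and the
  labels read from there.  Two presentations give the same cycle if they differ by moving the
  base point along the walk and possibly reversing the direction.
\<close>

definition same_mutation_cycle :: "'a quiver \<Rightarrow> 'a list \<Rightarrow> 'a quiver \<Rightarrow> 'a list \<Rightarrow> bool" where
  "same_mutation_cycle Q xs Q' ys \<longleftrightarrow>
     (\<exists>k < length xs. Q' = mutate_seq (take k xs) Q \<and>
        (ys = rotate k xs \<or> ys = rev (rotate k xs)))"

definition unique_simple_mutation_cycle :: "'a quiver \<Rightarrow> 'a list \<Rightarrow> bool" where
  "unique_simple_mutation_cycle Q xs \<longleftrightarrow>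
     simple_mutation_cycle Q xs \<and>
     (\<forall>Q' \<in> mutation_class Q. \<forall>ys. simple_mutation_cycle Q' ys \<longrightarrow> same_mutation_cycle Q xs Q' ys)"

end

theory Submission
  imports Defs
begin

text \<open>
  Call a direction \<open>i\<close> of an abundant quiver ascending if \<open>i\<close> is neither a source nor a sink and no
  oriented triangle through \<open>i\<close> has its heaviest edge opposite to \<open>i\<close>.  On four vertices, mutating in an
  ascending direction \<open>i\<close> increases the total number of arrows and makes every other direction
  ascending: the result is a fork with point of return \<open>i\<close>.  Hence a reduced closed walk never uses an
  ascending direction, and a closed walk of quivers that have only the two directions of the
  walk non-ascending carries the only simple cycle of its mutation class.

  It remains to see that the proposed cycle closes up and has this tightness property.  Let
  \<open>v1 \<rightarrow> v2 \<rightarrow> v3\<close> be the order of the acyclic quiver, so that the reddening source sequence is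
  \<open>v1, v2, v3\<close> and \<open>M\<close>, if nonempty, starts with \<open>v2\<close>.  From both quivers \<open>4 \<rightarrow> H'\<close> and
  \<open>H' \<rightarrow> 4\<close> one walks back along \<open>M\<close> to the acyclic centre.  The arrows at vertex 4 on the two
  descents satisfy explicit inequalities, exchanged by reversing all arrows, and
  the two rows are linked by a product of transvections along
  the vertices, which at the centre is exactly the effect of mutating at \<open>v1, v2, v3\<close>.
\<close>

section \<open>Matrix mutation and ascending directions\<close>

text \<open>The triangle on the three vertices of \<open>H\<close> is controlled along
  \<open>M\<close> by its heaviest edge alone. The row of vertex 4 is the obstacle: each mutation
  branches on the sign of one of its entries, so the invariant must be strong enough to decide that
  sign and must survive every sequence \<open>M\<close>. This is what the inequalities in
  \<open>row_state\<close> are tuned for; their coefficients are arrow counts diminished by one.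

  Inequalities cannot show that the walk closes up; this takes an equation. For a row, the formulas
  used when the entry at the mutated vertex \<open>k\<close> is positive or negative differ by plus
  or minus that entry times row \<open>k\<close> of the matrix: a transvection. The two ends carry
  opposite rows, so their first mutations take opposite branches, and \<open>row_link\<close>
  records the discrepancy from then on.

  For uniqueness, a quiver on the cycle must reveal its position. Its non-ascending directions
  reveal only the unordered pair of adjacent labels; that 4 labels exactly one step of the cycle
  removes the remaining ambiguity.\<close>

definition mut :: "'a \<Rightarrow> ('a \<Rightarrow> 'a \<Rightarrow> int) \<Rightarrow> 'a \<Rightarrow> 'a \<Rightarrow> int" where
  "mut i b u v =
     (if u = i \<or> v = i then - b u v
      else b u v + (if b u i > 0 \<and> b i v > 0 then b u i * b i v
                    else if b u i < 0 \<and> b i v < 0 then - (b u i * b i v) else 0))"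

definition skew :: "('a \<Rightarrow> 'a \<Rightarrow> int) \<Rightarrow> bool" where
  "skew b \<longleftrightarrow> (\<forall>u v. b v u = - b u v)"

lemma skewD: "skew b \<Longrightarrow> b v u = - b u v"
  unfolding skew_def by blast

lemma skew_diag: "skew b \<Longrightarrow> b u u = 0"
  using skewD[of b u u] by simp

lemma skew_mut: "skew b \<Longrightarrow> skew (mut i b)"
  unfolding skew_def
proof (intro allI)
  fix u v
  assume s: "\<forall>u v. b v u = - b u v"
  have "b v u = - b u v" "b v i = - b i v" "b i u = - b u i" using s by blast+
  then show "mut i b v u = - mut i b u v" unfolding mut_def by (auto simp: mult.commute)
qed

lemma mut_mut: assumes "skew b" shows "mut i (mut i b) = b"
proof (intro ext)
  fix u v
  show "mut i (mut i b) u v = b u v"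
  proof (cases "u = i \<or> v = i")
    case True then show ?thesis unfolding mut_def by auto
  next
    case False
    then have "mut i b u i = - b u i" "mut i b i v = - b i v" unfolding mut_def by auto
    then show ?thesis using False
      unfolding mut_def[of i "mut i b" u v] by (simp add: mut_def[of i b u v])
  qed
qed

lemma mut_uminus: "mut i (- b) = - mut i b"
proof (intro ext)
  fix u v
  have m: "(- c) x y = - c x y" for c :: "'a \<Rightarrow> 'a \<Rightarrow> int" and x y by simp
  show "mut i (- b) u v = (- mut i b) u v"
    unfolding mut_def m neg_0_less_iff_less neg_less_0_iff_less minus_mult_minus
    by (cases "b u i < 0"; cases "0 < b u i"; cases "b i v < 0"; cases "0 < b i v") simp_all
qed

lemma skew_uminus: assumes "skew b" shows "skew (- b)"
  unfolding skew_def using skewD[OF assms] by (metis uminus_apply)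

lemma skew_fold_mut: "skew b \<Longrightarrow> skew (fold mut xs b)"
  by (induction xs arbitrary: b) (auto simp: skew_mut)

lemma fold_mut_rev: "skew b \<Longrightarrow> fold mut (rev xs) (fold mut xs b) = b"
  by (induction xs arbitrary: b) (auto simp: skew_mut mut_mut)

lemma mut_agree:
  assumes "\<forall>u\<in>W. \<forall>v\<in>W. b u v = b' u v" "i \<in> W"
  shows "\<forall>u\<in>W. \<forall>v\<in>W. mut i b u v = mut i b' u v"
  using assms by (simp add: mut_def)

lemma fold_mut_agree:
  assumes "\<forall>u\<in>W. \<forall>v\<in>W. b u v = b' u v" "set xs \<subseteq> W"
  shows "\<forall>u\<in>W. \<forall>v\<in>W. fold mut xs b u v = fold mut xs b' u v"
  using assms
proof (induction xs arbitrary: b b')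
  case (Cons x xs)
  have "\<forall>u\<in>W. \<forall>v\<in>W. mut x b u v = mut x b' u v"
    using Cons.prems by (intro mut_agree) auto
  then show ?case using Cons.IH Cons.prems(2) by simp
qed simp

text \<open>The last condition says that no oriented triangle through \<open>i\<close> has its heaviest edge opposite to \<open>i\<close>,
  ties included.\<close>

definition ascending :: "'a set \<Rightarrow> ('a \<Rightarrow> 'a \<Rightarrow> int) \<Rightarrow> 'a \<Rightarrow> bool" where
  "ascending V b i \<longleftrightarrow> i \<in> V \<and> (\<forall>u\<in>V. \<forall>v\<in>V. u \<noteq> v \<longrightarrow> \<bar>b u v\<bar> \<ge> 2) \<and>
     (\<exists>u\<in>V. b u i > 0) \<and> (\<exists>v\<in>V. b i v > 0) \<and>
     (\<forall>u\<in>V. \<forall>v\<in>V. b u i > 0 \<and> b i v > 0 \<and> b v u > 0 \<longrightarrow> b v u < b u i \<or> b v u < b i v)"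

lemma ascending_abundant: "ascending V b i \<Longrightarrow> u \<in> V \<Longrightarrow> v \<in> V \<Longrightarrow> u \<noteq> v \<Longrightarrow> \<bar>b u v\<bar> \<ge> 2"
  unfolding ascending_def by blast

lemma ascending_uminus: assumes "skew b" "ascending V b i" shows "ascending V (- b) i"
proof -
  have s: "b v u = - b u v" for u v using assms(1) by (rule skewD)
  have 1: "(- b) u v = b v u" for u v using s[of u v] by simp
  have 2: "\<bar>b v u\<bar> = \<bar>b u v\<bar>" for u v using s[of u v] by simp
  show ?thesis using assms(2) unfolding ascending_def 1 2 by blast
qed

lemma two_le_mult:
  fixes a c :: int assumes "a \<ge> 2" "c \<ge> 2" shows "a * c \<ge> 2 * a" "a * c \<ge> 2 * c"
  using assms mult_left_mono[of 2 c a] mult_right_mono[of 2 a c] by simp_all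

text \<open>A product of two integers that are at least 2 is at least twice the larger factor. If
  the old edge runs against the path, it is lighter than that factor because \<open>i\<close>
  ascends, so what remains still exceeds both legs and the old edge.\<close>

lemma mut_through:
  assumes g: "ascending V b i" and uv: "u \<in> V" "v \<in> V" "b u i > 0" "b i v > 0" and s: "skew b"
  shows "mut i b u v > b u i" "mut i b u v > b i v" "mut i b u v > \<bar>b u v\<bar>"
proof -
  have i: "i \<in> V" using g unfolding ascending_def by blast
  have d: "u \<noteq> i" "v \<noteq> i" using uv skew_diag[OF s] by auto
  have uv': "u \<noteq> v" using uv skewD[OF s, of v i] by auto
  have ge: "b u i \<ge> 2" "b i v \<ge> 2"
    using ascending_abundant[OF g uv(1) i d(1)] ascending_abundant[OF g uv(2) i d(2)] uv skewD[OF s, of v i] by auto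
  have m: "mut i b u v = b u v + b u i * b i v" using d uv by (simp add: mut_def)
  have a: "b u v > 0 \<or> b v u > 0" using ascending_abundant[OF g uv(1,2) uv'] skewD[OF s, of u v] by linarith
  have c: "b v u > 0 \<Longrightarrow> b v u < b u i \<or> b v u < b i v"
    using g uv unfolding ascending_def by blast
  have "b u v = - b v u" by (rule skewD[OF s])
  then show "mut i b u v > b u i" "mut i b u v > b i v" "mut i b u v > \<bar>b u v\<bar>"
    using two_le_mult[OF ge] m a c ge by linarith+
qed

lemma mut_abs_mono:
  assumes g: "ascending V b i" and uv: "u \<in> V" "v \<in> V" and s: "skew b"
  shows "\<bar>b u v\<bar> \<le> \<bar>mut i b u v\<bar>"
proof (cases "u = i \<or> v = i")
  case True then show ?thesis by (auto simp: mut_def)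
next
  case F: False
  show ?thesis
  proof (cases "b u i > 0 \<and> b i v > 0")
    case True then show ?thesis using mut_through(3)[OF g uv _ _ s] by simp
  next
    case F2: False
    show ?thesis
    proof (cases "b u i < 0 \<and> b i v < 0")
      case True
      have "b v i > 0" "b i u > 0" using True skewD[OF s, of i v] skewD[OF s, of u i] by simp_all
      then have "mut i b v u > \<bar>b v u\<bar>" using mut_through(3)[OF g uv(2,1) _ _ s] by blast
      moreover have "b u v = - b v u" "mut i b u v = - mut i b v u"
        using skewD[OF s] skewD[OF skew_mut[OF s]] by blast+
      ultimately show ?thesis by linarith
    next
      case False then show ?thesis using F F2 unfolding mut_def by (auto split: if_splits)
    qed
  qed
qed

definition weight :: "'a set \<Rightarrow> ('a \<Rightarrow> 'a \<Rightarrow> int) \<Rightarrow> int" where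
  "weight V b = (\<Sum>u\<in>V. \<Sum>v\<in>V. \<bar>b u v\<bar>)"

lemma weight_less:
  assumes g: "ascending V b i" and s: "skew b" and f: "finite V"
  shows "weight V b < weight V (mut i b)"
proof -
  obtain u v where uv: "u \<in> V" "v \<in> V" "b u i > 0" "b i v > 0" using g unfolding ascending_def by blast
  have l: "(\<Sum>v\<in>V. \<bar>b w v\<bar>) \<le> (\<Sum>v\<in>V. \<bar>mut i b w v\<bar>)" if "w \<in> V" for w
    by (intro sum_mono mut_abs_mono[OF g _ _ s] that)
  have "(\<Sum>v\<in>V. \<bar>b u v\<bar>) < (\<Sum>v\<in>V. \<bar>mut i b u v\<bar>)"
    using mut_through(3)[OF g uv s] uv
    by (intro sum_strict_mono_ex1 f) (auto intro!: mut_abs_mono[OF g _ _ s] bexI[of _ v])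
  then show ?thesis unfolding weight_def using l uv f
    by (intro sum_strict_mono_ex1 f) auto
qed

text \<open>An oriented triangle through \<open>i\<close> and \<open>j\<close> has its heaviest edge
  opposite to \<open>i\<close>, by \<open>mut_through\<close>, and this edge ends at
  \<open>j\<close>. A triangle avoiding \<open>i\<close> consists of all the other vertices, since
  there are only four, and it turns out not to be oriented.\<close>

lemma ascending_mut:
  assumes s: "skew b" and g: "ascending V b i" and V: "card V = 4" and j: "j \<in> V" "j \<noteq> i"
  shows "ascending V (mut i b) j"
proof -
  let ?b = "mut i b"
  have f: "finite V" using V card.infinite by fastforce
  have i: "i \<in> V" using g unfolding ascending_def by blast
  have s': "?b v u = - ?b u v" for u v by (rule skewD[OF skew_mut[OF s]])
  have sb: "b v u = - b u v" for u v by (rule skewD[OF s])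
  have bi: "?b u i = b i u" "?b i u = b u i" for u using sb[of i u] sb[of u i] by (simp_all add: mut_def)
  obtain x y where xy: "x \<in> V" "y \<in> V" "b x i > 0" "b i y > 0" using g unfolding ascending_def by blast
  have ab: "\<bar>?b u v\<bar> \<ge> 2" if "u \<in> V" "v \<in> V" "u \<noteq> v" for u v
    using mut_abs_mono[OF g that(1,2) s] ascending_abundant[OF g that] by linarith
  have thr: "?b u v > ?b i u" "?b u v > ?b v i" if "u \<in> V" "v \<in> V" "?b i u > 0" "?b v i > 0" for u v
    using mut_through[OF g that(1,2) _ _ s] that by (simp_all add: bi)
  have side: "?b i u > 0 \<or> ?b u i > 0" if "u \<in> V" "u \<noteq> i" for u
    using ab[OF i that(1)] that s'[of i u] by fastforce
  have nonempty: "(\<exists>u\<in>V. ?b u j > 0) \<and> (\<exists>v\<in>V. ?b j v > 0)"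
  proof (cases "?b i j > 0")
    case True
    then have "?b j y > 0" using thr[OF j(1) xy(2)] xy(4) unfolding bi by (meson less_trans)
    then show ?thesis using True i xy by blast
  next
    case False
    then have 1: "?b j i > 0" using side[OF j] by blast
    then have "?b x j > 0" using thr[OF xy(1) j(1)] xy(3) unfolding bi by (meson less_trans)
    then show ?thesis using 1 i xy by blast
  qed
  have cyc: "?b v u < ?b u j \<or> ?b v u < ?b j v"
    if uv: "u \<in> V" "v \<in> V" and c: "?b u j > 0" "?b j v > 0" "?b v u > 0" for u v
  proof -
    have d: "u \<noteq> j" "j \<noteq> v" "v \<noteq> u" using c skew_diag[OF skew_mut[OF s]] by fastforce+
    consider "u = i" | "v = i" | "u \<noteq> i" "v \<noteq> i" by blast
    then show ?thesis
    proof cases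
      case 1 then show ?thesis using thr[OF j(1) uv(2)] c by simp
    next
      case 2 then show ?thesis using thr[OF uv(1) j(1)] c by simp
    next
      case 3
      \<comment> \<open>No arrow runs from a predecessor of \<open>i\<close> to a successor of
        \<open>i\<close>. Going round the oriented triangle, all three vertices lie on the same side
        of \<open>i\<close>, which would make \<open>i\<close> a source or a sink.\<close>
      have no: False if "p \<in> V" "q \<in> V" "?b p q > 0" "?b i q > 0" "?b p i > 0" for p q
        using thr[OF that(2,1) that(4,5)] that s'[of p q] by linarith
      have four: "V = {i, u, v, j}"
      proof (rule sym, rule card_subset_eq[OF f])
        show "{i, u, v, j} \<subseteq> V" using i uv j by blast
        show "card {i, u, v, j} = card V" using V d 3 j by auto
      qed
      have sd: "?b i u > 0 \<longleftrightarrow> \<not> ?b u i > 0" "?b i v > 0 \<longleftrightarrow> \<not> ?b v i > 0" "?b i j > 0 \<longleftrightarrow> \<not> ?b j i > 0"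
        using side[OF uv(1) 3(1)] side[OF uv(2) 3(2)] side[OF j] s'[of i u] s'[of i v] s'[of i j] by linarith+
      have e: "?b i u > 0 \<longleftrightarrow> ?b i v > 0" "?b i u > 0 \<longleftrightarrow> ?b i j > 0"
        using no[OF uv(1) j(1) c(1)] no[OF j(1) uv(2) c(2)] no[OF uv(2,1) c(3)] sd by blast+
      have X: "x \<in> {u, v, j}" "y \<in> {u, v, j}" using xy four skew_diag[OF s, of i] by auto
      have "?b i x > 0" "?b y i > 0" using xy by (simp_all add: bi)
      then have False using X e sd by blast
      then show ?thesis ..
    qed
  qed
  show ?thesis unfolding ascending_def using j ab nonempty cyc by blast
qed

section \<open>The arrows at the fourth vertex\<close>

text \<open>
  In a triangle \<open>x, y, z\<close> put \<open>p = b x y\<close>, \<open>q = b y z\<close>, \<open>r = b z x\<close>; either it is acyclic (\<open>r < 0\<close>) or an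
  oriented cycle whose heaviest edge exceeds the sum of the others and is not opposite to \<open>y\<close>.
\<close>

definition triangle :: "int \<Rightarrow> int \<Rightarrow> int \<Rightarrow> bool" where
  "triangle p q r \<longleftrightarrow> p \<ge> 2 \<and> q \<ge> 2 \<and> (r \<le> - 2 \<or> r \<ge> 2 \<and> (q \<ge> p + r + 2 \<or> p \<ge> q + r + 2))"

text \<open>
  The invariant of the descent: \<open>y\<close> is the vertex mutated last, \<open>ux, uy, uz\<close> count the arrows from
  \<open>x, y, z\<close> to the fourth vertex.  Mutating at \<open>x\<close> or \<open>z\<close> preserves it, the new triangles being
  \<open>y, x, z\<close> and \<open>x, z, y\<close>.
\<close>

definition row_state :: "int \<Rightarrow> int \<Rightarrow> int \<Rightarrow> int \<Rightarrow> int \<Rightarrow> int \<Rightarrow> bool" where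
  "row_state p q r ux uy uz \<longleftrightarrow>
     ux \<ge> 2 \<and> uy \<le> - 2 \<and> uz > (q - 1) * (- uy) \<or>
     ux \<le> - 2 \<and> \<bar>uy\<bar> \<ge> 2 \<and> uz \<ge> 2 \<and> - ux > (p - 1) * uy \<and>
       uz + (q - 1) * uy + (p * q - r - 1) * ux > 0"

lemma mult_ge_of_le:
  fixes a c d :: int assumes "c \<ge> d" "a \<ge> 0" shows "c * a \<ge> d * a"
  using assms by (rule mult_right_mono)

lemma le_mult_self:
  fixes a c :: int assumes "a \<ge> 1" "c \<ge> 2" shows "a * c \<ge> c" "a * c \<ge> 2 * a"
  using assms mult_right_mono[of 1 a c] mult_left_mono[of 2 c a] by simp_all

lemma triangle_coeff:
  assumes "triangle p q r" shows "p * q - r - 1 \<ge> p + 1" "p * q - r - 1 \<ge> q + 1"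
proof -
  have pq: "p \<ge> 2" "q \<ge> 2" using assms unfolding triangle_def by auto
  have "p * q \<ge> 2 * p" "p * q \<ge> 2 * q" using two_le_mult[OF pq] .
  then show "p * q - r - 1 \<ge> p + 1" "p * q - r - 1 \<ge> q + 1"
    using assms unfolding triangle_def by linarith+
qed

text \<open>For \<open>uy < 0\<close> both alternatives give \<open>uz > (q - 1) * (- uy)\<close>:
  in the second one the coefficient of the negative \<open>ux\<close> is positive. This product is
  at least \<open>- uy\<close> and at least \<open>2 * (q - 1)\<close>. The case
  \<open>uy > 0\<close> is the same estimate with \<open>p\<close> and \<open>- ux\<close>.\<close>

lemma row_state_bounds:
  assumes t: "triangle p q r" and u: "row_state p q r ux uy uz"
  shows "\<bar>ux\<bar> \<ge> 2" "\<bar>uy\<bar> \<ge> 2" "uz \<ge> 2" "ux > 0 \<Longrightarrow> uy < 0"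
    "uy < 0 \<Longrightarrow> uz > - uy \<and> uz > q" "uy > 0 \<Longrightarrow> - ux > uy \<and> - ux > p"
proof -
  have pq: "p \<ge> 2" "q \<ge> 2" using t unfolding triangle_def by auto
  have c: "p * q - r - 1 \<ge> 1" using triangle_coeff[OF t] pq by linarith
  have 1: "uz > (q - 1) * (- uy)" if "uy < 0"
    using u mult_ge_of_le[OF c, of "- ux"] unfolding row_state_def by (smt (verit, ccfv_threshold) mult_minus_right that)
  have 2: "uz > - uy \<and> uz > q" if "uy < 0"
  proof -
    have y: "uy \<le> - 2" using u that unfolding row_state_def by linarith
    define W where "W = (q - 1) * (- uy)"
    have "W \<ge> - uy" "W \<ge> 2 * (q - 1)" using le_mult_self[of "q - 1" "- uy"] pq y unfolding W_def by auto
    moreover have "uz > W" using 1[OF that] unfolding W_def .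
    ultimately show ?thesis using pq by auto
  qed
  then show "uy < 0 \<Longrightarrow> uz > - uy \<and> uz > q" .
  show "\<bar>ux\<bar> \<ge> 2" "\<bar>uy\<bar> \<ge> 2" using u unfolding row_state_def by linarith+
  show "uz \<ge> 2" using u 2 unfolding row_state_def by linarith
  show "ux > 0 \<Longrightarrow> uy < 0" using u unfolding row_state_def by linarith
  show "- ux > uy \<and> - ux > p" if "uy > 0"
  proof -
    have y: "uy \<ge> 2" "- ux > (p - 1) * uy" using u that unfolding row_state_def by linarith+
    define W where "W = (p - 1) * uy"
    have "W \<ge> uy" "W \<ge> 2 * (p - 1)" using le_mult_self[of "p - 1" uy] pq y unfolding W_def by auto
    moreover have "- ux > W" using y unfolding W_def by blast
    ultimately show ?thesis using pq by auto
  qed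
qed

text \<open>Whatever the sign of \<open>ux\<close>, the new first entry is negative, so the new row
  satisfies the second alternative of \<open>row_state\<close>.\<close>

lemma row_state_step_x:
  assumes u: "row_state p q r ux uy uz" and pq: "p \<ge> 2" "r \<ge> 2" "q \<ge> p + r + 2"
  shows "row_state p r (p * r - q) (uy + (if ux < 0 then p * ux else 0)) (- ux)
           (uz + (if ux > 0 then r * ux else 0))"
proof -
  have t: "triangle p q r" using pq unfolding triangle_def by auto
  note b = row_state_bounds[OF t u]
  \<comment> \<open>\<open>p * q - r\<close> counts the arrows \<open>x \<rightarrow> z\<close>
    before the mutation at \<open>y\<close>. In the new state the last mutation is the one at
    \<open>x\<close>, and the count before it is the old \<open>q\<close>.\<close>
  have e: "p * r - (p * r - q) - 1 = q - 1" by simp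
  show ?thesis
  proof (cases "ux > 0")
    case True
    then have y: "uy \<le> - 2" "ux \<ge> 2" "uz > (q - 1) * (- uy)" using u unfolding row_state_def by auto
    have m: "r * ux \<ge> 2 * ux" "p * ux \<ge> 2 * ux" using pq y by (intro mult_ge_of_le; simp)+
    have n: "(q - 1) * (- uy) \<ge> 0" using y pq by (intro mult_nonneg_nonneg) auto
    have "(p - 1) * (- ux) = ux - p * ux" by (simp add: algebra_simps)
    then have 1: "- uy > (p - 1) * (- ux)" using m y by linarith
    have 2: "uz + r * ux \<ge> 2" using m n y by linarith
    have "uz + r * ux + (r - 1) * (- ux) + (q - 1) * uy = uz + (q - 1) * uy + ux"
      by (simp add: algebra_simps)
    then have "uz + r * ux + (r - 1) * (- ux) + (q - 1) * uy > 0" using y by simp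
    then show ?thesis unfolding row_state_def e using True y 1 2 by auto
  next
    case False
    then have x: "ux \<le> - 2" "\<bar>uy\<bar> \<ge> 2" "uz \<ge> 2" "- ux > (p - 1) * uy"
      "uz + (q - 1) * uy + (p * q - r - 1) * ux > 0" using u b unfolding row_state_def by auto
    have px: "p * (- ux) \<ge> 2 * (- ux)" using pq x by (intro mult_ge_of_le) auto
    have uyx: "uy < - ux" using x b(6) by linarith
    have "uz + (r - 1) * (- ux) + (q - 1) * (uy + p * ux) =
      (uz + (q - 1) * uy + (p * q - r - 1) * ux) + (p - 2) * (- ux)"
      by (simp add: algebra_simps)
    moreover have "(p - 2) * (- ux) \<ge> 0" using pq x by (intro mult_nonneg_nonneg) auto
    ultimately have E: "uz + (r - 1) * (- ux) + (q - 1) * (uy + p * ux) > 0" using x by linarith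
    have "uy + p * ux \<le> - 2"
    proof (cases "uy > 0")
      case True
      have "2 * (p - 1) \<le> uy * (p - 1)" using True x pq by (intro mult_right_mono) auto
      then show ?thesis using px x b(6) True pq by linarith
    next
      case F: False then show ?thesis using px x by linarith
    qed
    moreover have "- (uy + p * ux) > (p - 1) * (- ux)" using uyx by (simp add: algebra_simps)
    ultimately show ?thesis using False x E unfolding row_state_def e by auto
  qed
qed

text \<open>\<open>uz\<close> is always positive, so only one branch of the mutation rule occurs.
  The entry \<open>ux\<close> does not change, hence the alternative of \<open>row_state\<close> is
  kept.\<close>

lemma row_state_step_z:
  assumes u: "row_state p q r ux uy uz" and pq: "q \<ge> 2" "r \<ge> 2" "p \<ge> q + r + 2"
  shows "row_state r q (r * q - p) ux (- uz) (uy + q * uz)"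
proof -
  have t: "triangle p q r" using pq unfolding triangle_def by auto
  note b = row_state_bounds[OF t u]
  have e: "r * q - (r * q - p) - 1 = p - 1" by simp
  have qz: "q * uz \<ge> 2 * uz" using pq b(3) by (intro mult_ge_of_le) auto
  show ?thesis
  proof (cases "ux > 0")
    case True
    then show ?thesis using b unfolding row_state_def by (auto simp: algebra_simps)
  next
    case False
    then have x: "ux \<le> - 2" "\<bar>uy\<bar> \<ge> 2" "uz \<ge> 2" "- ux > (p - 1) * uy"
      "uz + (q - 1) * uy + (p * q - r - 1) * ux > 0" using u b unfolding row_state_def by auto
    have pp: "p * q \<ge> 2 * p" using pq by (intro two_le_mult) auto
    \<comment> \<open>This is the last inequality of the new state: \<open>(q - 1) * (- uz)\<close>
      is absorbed by the summand \<open>q * uz\<close> of the new entry at \<open>y\<close>.\<close>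
    have main: "uz + uy + (p - 1) * ux > 0"
    proof (cases "uy > 0")
      case True
      have "(p - 1) * (q - 1) \<ge> (p - 1) * 1" using pq by (intro mult_left_mono) auto
      then have "p * q - r - 1 - (q - 2) \<ge> p - 1" using pq by (simp add: algebra_simps)
      then have "(p * q - r - 1 - (q - 2)) * (- ux) \<ge> (p - 1) * (- ux)"
        using x by (intro mult_ge_of_le) auto
      moreover have "(q - 2) * uy \<le> (q - 2) * (- ux)" using b(6) True pq by (intro mult_left_mono) auto
      ultimately show ?thesis using x(5) by (simp add: algebra_simps)
    next
      case F: False
      have "p * q - r - 1 \<ge> p - 1" using pp pq by linarith
      then have "(p * q - r - 1) * (- ux) \<ge> (p - 1) * (- ux)" using x by (intro mult_ge_of_le) auto
      moreover have "(q - 1) * (- uy) \<ge> 1 * (- uy)" using F pq by (intro mult_ge_of_le) auto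
      ultimately show ?thesis using x(5) by (simp add: algebra_simps)
    qed
    have "(q - 1) * (- uz) = uz - q * uz" by (simp add: algebra_simps)
    moreover have "uy + q * uz \<ge> 2" using qz b(3,5) x by linarith
    moreover have "(r - 1) * uz \<ge> 0" using pq x by simp
    then have "- ux > (r - 1) * (- uz)" using x by linarith
    ultimately show ?thesis using x main e unfolding row_state_def by auto
  qed
qed

text \<open>For \<open>ux < 0\<close>, mutating at the source \<open>x\<close> of the acyclic
  triangle adds \<open>p * ux\<close> to the entry at \<open>y\<close> and \<open>- r * ux\<close>
  to the entry at \<open>z\<close>. The bounds from the third on concern the row after this
  mutation.\<close>

lemma row_state_center:
  assumes u: "row_state p q r ux uy uz" and pq: "p \<ge> 2" "q \<ge> 2" "r \<le> - 2" and x: "ux < 0"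
  shows "uz > - ux" "uz > - r" "uy + p * ux \<le> - 2" "- (uy + p * ux) > p \<or> - ux > p"
    "uz - r * ux > - (uy + p * ux)" "uz - r * ux > q"
proof -
  have t: "triangle p q r" using pq unfolding triangle_def by auto
  note b = row_state_bounds[OF t u]
  have x: "ux \<le> - 2" "\<bar>uy\<bar> \<ge> 2" "uz \<ge> 2" "- ux > (p - 1) * uy"
      "uz + (q - 1) * uy + (p * q - r - 1) * ux > 0" using u b x unfolding row_state_def by auto
  have px: "p * (- ux) \<ge> 2 * (- ux)" "(- ux) * p \<ge> 2 * p" using pq x by (intro mult_ge_of_le; simp)+
  show neg: "uy + p * ux \<le> - 2"
  proof (cases "uy > 0")
    case True
    have "2 * (p - 1) \<le> uy * (p - 1)" using True x pq by (intro mult_right_mono) auto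
    then show ?thesis using px x b(6) True pq by linarith
  next
    case F: False then show ?thesis using px x by linarith
  qed
  show "- (uy + p * ux) > p \<or> - ux > p" using b(6) px x pq by (smt (verit) mult.commute mult_minus_left)
  define Y where "Y = - (uy + p * ux)"
  \<comment> \<open>The last inequality of \<open>row_state\<close>, rewritten with the new entry
    \<open>- Y\<close> at \<open>y\<close>: the other summands are nonnegative, and the new entry at
    \<open>z\<close> exceeds \<open>(q - 1) * Y\<close>.\<close>
  have eq: "uz - r * ux = (uz + (q - 1) * uy + (p * q - r - 1) * ux) + (q - 1) * Y + (p - 1) * (- ux)"
    by (simp add: algebra_simps Y_def)
  define W where "W = (q - 1) * Y"
  have w: "W \<ge> Y" "W \<ge> 2 * (q - 1)" using le_mult_self[of "q - 1" Y] pq neg unfolding W_def Y_def by auto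
  have "(p - 1) * (- ux) \<ge> 0" using pq x by (intro mult_nonneg_nonneg) auto
  then have U: "uz - r * ux > W" using eq[folded W_def] x(5) by linarith
  have 1: "uz - r * ux > Y" using U w(1) by linarith
  have "q < 2 * (q - 1) + 1" using pq(2) by simp
  then have 2: "uz - r * ux > q" using U w(2) by linarith
  show "uz - r * ux > - (uy + p * ux)" using 1 unfolding Y_def .
  show "uz - r * ux > q" by (rule 2)
  have "(- r) * (- ux) \<ge> - ux" "(- r) * (- ux) \<ge> 2 * (- r)"
    using le_mult_self[of "- r" "- ux"] pq x by auto
  then have "r * ux \<ge> - ux" "r * ux \<ge> 2 * (- r)" by simp_all
  then show "uz > - ux" "uz > - r" using 2 pq by linarith+
qed

text \<open>\<open>A\<close>, \<open>C\<close>, \<open>E\<close> are \<open>b i a\<close>, \<open>b i c\<close> and \<open>b a c\<close>.\<close>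

definition undominated :: "int \<Rightarrow> int \<Rightarrow> int \<Rightarrow> bool" where
  "undominated A C E \<longleftrightarrow> (A < 0 \<and> C > 0 \<and> E < 0 \<longrightarrow> E > A \<or> - E < C) \<and> (C < 0 \<and> A > 0 \<and> E > 0 \<longrightarrow> E < - C \<or> E < A)"

lemma ascending_four:
  assumes s: "skew b" and V: "V = {i, a, c, d}"
    and ab: "\<bar>b i a\<bar> \<ge> 2" "\<bar>b i c\<bar> \<ge> 2" "\<bar>b i d\<bar> \<ge> 2" "\<bar>b a c\<bar> \<ge> 2" "\<bar>b a d\<bar> \<ge> 2" "\<bar>b c d\<bar> \<ge> 2"
    and out: "b i a > 0 \<or> b i c > 0 \<or> b i d > 0" and "in": "b i a < 0 \<or> b i c < 0 \<or> b i d < 0"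
    and cyc: "undominated (b i a) (b i c) (b a c)" "undominated (b i a) (b i d) (b a d)" "undominated (b i c) (b i d) (b c d)"
  shows "ascending V b i"
proof -
  have n: "b a i = - b i a" "b c i = - b i c" "b d i = - b i d" "b c a = - b a c" "b d a = - b a d" "b d c = - b c d"
    using skewD[OF s] by blast+
  have z: "b i i = 0" "b a a = 0" "b c c = 0" "b d d = 0" using skew_diag[OF s] by blast+
  have 1: "\<forall>u\<in>V. \<forall>v\<in>V. u \<noteq> v \<longrightarrow> \<bar>b u v\<bar> \<ge> 2" unfolding V using ab by (simp add: n)
  have 2: "\<exists>u\<in>V. b u i > 0" "\<exists>v\<in>V. b i v > 0" unfolding V using out "in" by (auto simp: n)
  have 3: "\<forall>u\<in>V. \<forall>v\<in>V. b u i > 0 \<and> b i v > 0 \<and> b v u > 0 \<longrightarrow> b v u < b u i \<or> b v u < b i v"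
    unfolding V ball_simps n z using cyc unfolding undominated_def by auto
  show ?thesis unfolding ascending_def using 1 2 3 V by blast
qed

text \<open>
  With \<open>T h u = u + u h \<cdot> b h\<close> (a transvection), this is \<open>w = - T z (T y (T x u))\<close>, where \<open>T x\<close> occurs only
  if \<open>ux < 0\<close> and \<open>T z\<close> only if \<open>wz > 0\<close>.
\<close>

definition row_link :: "int \<Rightarrow> int \<Rightarrow> int \<Rightarrow> int \<Rightarrow> int \<Rightarrow> int \<Rightarrow> int \<Rightarrow> int \<Rightarrow> int \<Rightarrow> bool" where
  "row_link p q r ux uy uz wx wy wz \<longleftrightarrow>
     (let vy = uy + (if ux < 0 then ux * p else 0); vz = uz - (if ux < 0 then ux * r else 0) in
       wy + (if wz > 0 then wz * q else 0) = - vy \<and>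
       wx - (if wz > 0 then wz * r else 0) = - ux + vy * p \<and>
       wz = - vz - vy * q)"

text \<open>Reversing all arrows exchanges the two descents.\<close>

lemma row_link_sym:
  assumes "row_link p q r ux uy uz wx wy wz"
  shows "row_link q p r (- wz) (- wy) (- wx) (- uz) (- uy) (- ux)"
proof -
  define e where "e = (if ux < 0 then ux else 0)"
  define d where "d = (if wz > 0 then wz else 0)"
  have "wy + d * q = - (uy + e * p)" "wx - d * r = - ux + (uy + e * p) * p" "wz = - (uz - e * r) - (uy + e * p) * q"
    using assms unfolding row_link_def Let_def d_def e_def by (auto split: if_splits)
  moreover have "(if - wz < 0 then - wz * k else 0) = - d * k" "(if - ux > 0 then - ux * k else 0) = - e * k" for k
    unfolding d_def e_def by auto
  moreover have "uy + e * p = - (wy + d * q)" using calculation by linarith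
  ultimately show ?thesis unfolding row_link_def Let_def by (simp add: algebra_simps)
qed

text \<open>The second row belongs to the descent from the other end. Read on the opposite quiver it
  is negated and \<open>x\<close>, \<open>z\<close> as well as \<open>p\<close>, \<open>q\<close>
  trade places, so that one invariant serves both descents.\<close>

definition row_pair :: "int \<Rightarrow> int \<Rightarrow> int \<Rightarrow> int \<Rightarrow> int \<Rightarrow> int \<Rightarrow> int \<Rightarrow> int \<Rightarrow> int \<Rightarrow> bool" where
  "row_pair p q r ux uy uz wx wy wz \<longleftrightarrow>
     row_state p q r ux uy uz \<and> row_state q p r (- wz) (- wy) (- wx) \<and> row_link p q r ux uy uz wx wy wz"

lemma row_pair_sym: "row_pair p q r ux uy uz wx wy wz \<Longrightarrow> row_pair q p r (- wz) (- wy) (- wx) (- uz) (- uy) (- ux)"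
  unfolding row_pair_def using row_link_sym by simp

lemma row_pair_step:
  assumes s: "row_pair p q r ux uy uz wx wy wz" and pq: "p \<ge> 2" "r \<ge> 2" "q \<ge> p + r + 2"
  shows "row_pair p r (p * r - q) (uy + (if ux < 0 then p * ux else 0)) (- ux)
           (uz + (if ux > 0 then r * ux else 0)) (wy + p * wx) (- wx) wz"
proof -
  have u: "row_state p q r ux uy uz" and w: "row_state q p r (- wz) (- wy) (- wx)"
    and R: "row_link p q r ux uy uz wx wy wz" using s unfolding row_pair_def by auto
  have t: "triangle p q r" "triangle q p r" using pq unfolding triangle_def by auto
  have wx: "wx < 0" using row_state_bounds(3)[OF t(2) w] by linarith
  have ux: "ux \<noteq> 0" using row_state_bounds(1)[OF t(1) u] by auto
  have u': "row_state p r (p * r - q) (uy + (if ux < 0 then p * ux else 0)) (- ux)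
           (uz + (if ux > 0 then r * ux else 0))" by (rule row_state_step_x[OF u pq])
  have w': "row_state r p (p * r - q) (- wz) (- (- wx)) (- (wy + p * wx))"
    using row_state_step_z[OF w] pq by (simp add: algebra_simps)
  \<comment> \<open>After the step \<open>y\<close> takes the first place. Its negative entry makes
    \<open>row_link\<close> include the transvection at \<open>y\<close>, so this factor of the
    product is not lost.\<close>
  have neg: "uy + (if ux < 0 then p * ux else 0) < 0"
  proof (cases "ux > 0")
    case True then show ?thesis using row_state_bounds(4)[OF t(1) u] by simp
  next
    case False
    then show ?thesis using u' ux unfolding row_state_def by auto
  qed
  define d where "d = (if wz > 0 then wz else 0)"
  have d: "(if wz > 0 then wz * k else 0) = d * k" for k unfolding d_def by simp
  have "row_link p r (p * r - q) (uy + (if ux < 0 then p * ux else 0)) (- ux)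
           (uz + (if ux > 0 then r * ux else 0)) (wy + p * wx) (- wx) wz"
  proof (cases "ux > 0")
    case True
    then have W: "wy = - uy - d * q" "wx = - ux + uy * p + d * r" "wz = - uz - uy * q"
      using R unfolding row_link_def Let_def d by auto
    show ?thesis unfolding row_link_def Let_def d W(1,2) using True neg W(3) by (simp add: algebra_simps)
  next
    case False
    then have n: "ux < 0" using ux by simp
    then have W: "wy = - (uy + ux * p) - d * q" "wx = - ux + (uy + ux * p) * p + d * r"
        "wz = - (uz - ux * r) - (uy + ux * p) * q"
      using R unfolding row_link_def Let_def d by auto
    show ?thesis unfolding row_link_def Let_def d W(1,2) using n neg W(3) by (simp add: algebra_simps)
  qed
  then show ?thesis unfolding row_pair_def using u' w' by simp
qed

text \<open>The rows at the two ends are \<open>ax, ay, az\<close> and their negatives. Mutation at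
  \<open>y\<close> takes opposite branches on them, which leaves a discrepancy of one transvection
  at \<open>y\<close>.\<close>

lemma row_pair_init:
  assumes pq: "q \<ge> 2" and a: "ax \<ge> 2" "ay \<ge> 2" "az \<ge> 2" and p: "p \<ge> 2"
  shows "row_pair p q r ax (- ay) (az + q * ay) (- ax - p * ay) ay (- az)"
  using assms unfolding row_pair_def row_state_def row_link_def Let_def by (auto simp: algebra_simps)

section \<open>Ascending directions along the descent\<close>

lemma ascending_t:
  assumes s: "skew b" and V: "V = {x, y, z, t}"
    and T: "triangle (b x y) (b y z) (b z x)" and u: "row_state (b x y) (b y z) (b z x) (b x t) (b y t) (b z t)"
  shows "ascending V b t"
proof -
  note bd = row_state_bounds[OF T u]
  have n: "b t x = - b x t" "b t y = - b y t" "b t z = - b z t" "b x z = - b z x"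
    by (rule skewD[OF s])+
  have pq: "b x y \<ge> 2" "b y z \<ge> 2" "b z x \<ge> 2 \<or> b z x \<le> - 2" using T unfolding triangle_def by auto
  have c: "b z t > - b z x" if "b z x \<le> - 2" "b x t < 0" by (rule row_state_center(2)[OF u pq(1,2) that])
  show ?thesis
    apply (rule ascending_four[OF s, of V t x y z])
    using V bd pq c unfolding n undominated_def by auto
qed

text \<open>The hypothesis \<open>d\<close> describes the states from which the descent goes on at
  \<open>x\<close>: the triangle is acyclic, or its heaviest edge is opposite to
  \<open>x\<close>.\<close>

lemma ascending_z:
  assumes s: "skew b" and V: "V = {x, y, z, t}"
    and T: "triangle (b x y) (b y z) (b z x)" and u: "row_state (b x y) (b y z) (b z x) (b x t) (b y t) (b z t)"
    and d: "b z x \<le> - 2 \<or> b y z \<ge> b x y + b z x + 2"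
  shows "ascending V b z"
proof -
  note bd = row_state_bounds[OF T u]
  have n: "b z y = - b y z" by (rule skewD[OF s])+
  have pq: "b x y \<ge> 2" "b y z \<ge> 2" "b z x \<ge> 2 \<or> b z x \<le> - 2" using T unfolding triangle_def by auto
  have c: "b z t > - b x t" if "b z x \<le> - 2" "b x t < 0" by (rule row_state_center(1)[OF u pq(1,2) that])
  show ?thesis
    apply (rule ascending_four[OF s, of V z x y t])
    using V bd pq c d unfolding n undominated_def by auto
qed

lemma ascending_x:
  assumes s: "skew b" and V: "V = {x, y, z, t}"
    and T: "triangle (b x y) (b y z) (b z x)" and u: "row_state (b x y) (b y z) (b z x) (b x t) (b y t) (b z t)"
    and d: "b z x > 0" "b x y \<ge> b y z + b z x + 2"
  shows "ascending V b x"
proof -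
  note bd = row_state_bounds[OF T u]
  have n: "b x z = - b z x" by (rule skewD[OF s])+
  have pq: "b x y \<ge> 2" "b y z \<ge> 2" "b z x \<ge> 2" using T d unfolding triangle_def by auto
  show ?thesis
    apply (rule ascending_four[OF s, of V x y z t])
    using V bd pq d unfolding n undominated_def by auto
qed

text \<open>The triangle stays acyclic, with \<open>x\<close> now its sink, so only triangles
  through \<open>t\<close> can be oriented. \<open>Y\<close> and \<open>Z\<close> are the new
  entries at \<open>y\<close> and \<open>z\<close>, bounded by
  \<open>row_state_center\<close>.\<close>

lemma ascending_after_source:
  assumes s: "skew b" and V: "V = {x, y, z, t}" and dist: "distinct [x, y, z, t]"
    and pq: "b x y \<ge> 2" "b y z \<ge> 2" "b z x \<le> - 2"
    and u: "row_state (b x y) (b y z) (b z x) (b x t) (b y t) (b z t)"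
  shows "ascending V (mut x b) z" "ascending V (mut x b) t"
proof -
  have T: "triangle (b x y) (b y z) (b z x)" using pq unfolding triangle_def by auto
  note bd = row_state_bounds[OF T u]
  let ?b = "mut x b"
  have s': "skew ?b" by (rule skew_mut[OF s])
  have n: "b t x = - b x t" "b x z = - b z x" "b y x = - b x y" by (rule skewD[OF s])+
  have n': "?b t x = - ?b x t" "?b t y = - ?b y t" "?b t z = - ?b z t" "?b z y = - ?b y z" "?b z x = - ?b x z"
    by (rule skewD[OF s'])+
  have e: "?b x y = - b x y" "?b x z = b z x" "?b y z = b y z" "?b x t = - b x t"
    using dist pq by (auto simp: mut_def n)
  have ey: "?b y t = (if b x t < 0 then b y t + b x y * b x t else b y t)"
    and ez: "?b z t = (if b x t < 0 then b z t - b z x * b x t else b z t)"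
    using dist pq by (auto simp: mut_def n)
  define Y where "Y = ?b y t"
  define Z where "Z = ?b z t"
  have k: "Y \<le> - 2" "- Y > b x y \<or> - b x t > b x y \<or> b x t > 0" "Z > - Y" "Z > b y z"
    using row_state_center(3-6)[OF u pq] bd unfolding Y_def Z_def ey ez by (auto split: if_splits)
  show "ascending V ?b z"
    apply (rule ascending_four[OF s', of V z x y t])
    using V pq bd k unfolding n' e undominated_def Y_def[symmetric] Z_def[symmetric] by auto
  show "ascending V ?b t"
    apply (rule ascending_four[OF s', of V t x y z])
    using V pq bd k unfolding n' e undominated_def Y_def[symmetric] Z_def[symmetric] by auto
qed

section \<open>The two descents as a pair of matrices\<close>

definition state_pair :: "'a \<Rightarrow> 'a \<Rightarrow> 'a \<Rightarrow> 'a \<Rightarrow> ('a \<Rightarrow> 'a \<Rightarrow> int) \<Rightarrow> ('a \<Rightarrow> 'a \<Rightarrow> int) \<Rightarrow> bool" where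
  "state_pair x y z t b b' \<longleftrightarrow> skew b \<and> skew b' \<and> distinct [x, y, z, t] \<and>
     b' x y = b x y \<and> b' y z = b y z \<and> b' z x = b z x \<and>
     row_pair (b x y) (b y z) (b z x) (b x t) (b y t) (b z t) (b' x t) (b' y t) (b' z t)"

lemma uminus_uminus_matrix: "- (- b) = (b :: 'a \<Rightarrow> 'a \<Rightarrow> int)"
  by (intro ext) simp

lemma state_pair_sym:
  assumes "state_pair x y z t b b'" shows "state_pair z y x t (- b') (- b)"
proof -
  have s: "skew b" "skew b'" using assms unfolding state_pair_def by auto
  have n: "(- b') z y = b' y z" "(- b') y x = b' x y" "(- b') x z = b' z x"
     "(- b) z y = b y z" "(- b) y x = b x y" "(- b) x z = b z x"
    using skewD[OF s(1)] skewD[OF s(2)] by (metis uminus_apply)+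
  show ?thesis using assms row_pair_sym skew_uminus unfolding state_pair_def n by auto
qed

lemma state_pair_step:
  assumes P: "state_pair x y z t b b'" and pq: "b x y \<ge> 2" "b z x \<ge> 2" "b y z \<ge> b x y + b z x + 2"
  shows "state_pair y x z t (mut x b) (mut x b')"
proof -
  have s: "skew b" "skew b'" and dist: "distinct [x, y, z, t]" and e: "b' x y = b x y" "b' y z = b y z" "b' z x = b z x"
    and R: "row_pair (b x y) (b y z) (b z x) (b x t) (b y t) (b z t) (b' x t) (b' y t) (b' z t)"
    using P unfolding state_pair_def by auto
  have n: "b t x = - b x t" "b x z = - b z x" "b y x = - b x y" "b z y = - b y z" by (rule skewD[OF s(1)])+
  have n': "b' t x = - b' x t" "b' x z = - b' z x" "b' y x = - b' x y" "b' z y = - b' y z" by (rule skewD[OF s(2)])+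
  have wx: "b' x t < 0"
  proof -
    have "triangle (b y z) (b x y) (b z x)" using pq unfolding triangle_def by auto
    from row_state_bounds(3)[OF this] show ?thesis using R unfolding row_pair_def by force
  qed
  have m: "mut x b y x = b x y" "mut x b x z = b z x" "mut x b z y = b x y * b z x - b y z"
    "mut x b' y x = b x y" "mut x b' x z = b z x" "mut x b' z y = b x y * b z x - b y z"
    using dist pq by (auto simp: mut_def n n' e)
  have "mut x b y t = b y t + (if b x t < 0 then b x y * b x t else 0)" "mut x b x t = - b x t"
    "mut x b z t = b z t + (if b x t > 0 then b z x * b x t else 0)"
    using dist pq by (auto simp: mut_def n n' e)
  moreover have "mut x b' y t = b' y t + b x y * b' x t" "mut x b' x t = - b' x t" "mut x b' z t = b' z t"
    using dist pq wx by (auto simp: mut_def n n' e)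
  ultimately show ?thesis
    unfolding state_pair_def m using s dist row_pair_step[OF R pq] by (auto simp: skew_mut)
qed

text \<open>A step at \<open>z\<close> is a step at \<open>x\<close> for the opposite matrices with
  the two ends exchanged.\<close>

lemma state_pair_step':
  assumes P: "state_pair x y z t b b'" and pq: "b y z \<ge> 2" "b z x \<ge> 2" "b x y \<ge> b y z + b z x + 2"
  shows "state_pair x z y t (mut z b) (mut z b')"
proof -
  have s: "skew b" "skew b'" and e: "b' x y = b x y" "b' y z = b y z" "b' z x = b z x"
    using P unfolding state_pair_def by auto
  have n: "(- b') z y = b' y z" "(- b') y x = b' x y" "(- b') x z = b' z x"
    using skewD[OF s(2)] by (metis uminus_apply)+
  have "state_pair y z x t (mut z (- b')) (mut z (- b))"
    using state_pair_step[OF state_pair_sym[OF P]] pq unfolding n e by simp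
  from state_pair_sym[OF this] show ?thesis by (simp add: mut_uminus uminus_uminus_matrix)
qed

lemma state_pair_init:
  assumes s: "skew b" "skew b'" and dist: "distinct [x, y, z, t]"
    and pq: "b y x \<ge> 2" "b z y \<ge> 2"
    and e: "b' x y = b x y" "b' y z = b y z" "b' z x = b z x"
    and a: "b x t \<ge> 2" "b y t \<ge> 2" "b z t \<ge> 2" "b' x t = - b x t" "b' y t = - b y t" "b' z t = - b z t"
  shows "state_pair x y z t (mut y b) (mut y b')"
proof -
  have n: "b t y = - b y t" "b x y = - b y x" "b y z = - b z y" by (rule skewD[OF s(1)])+
  have n': "b' t y = - b' y t" "b' y x = - b' x y" "b' z y = - b' y z" by (rule skewD[OF s(2)])+
  have m: "mut y b x y = b y x" "mut y b y z = b z y" "mut y b z x = b z x + b z y * b y x"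
    "mut y b' x y = b y x" "mut y b' y z = b z y" "mut y b' z x = b z x + b z y * b y x"
    using dist pq by (auto simp: mut_def n n' e)
  have "mut y b x t = b x t" "mut y b y t = - b y t" "mut y b z t = b z t + b z y * b y t"
    using dist pq a by (auto simp: mut_def n n' e)
  moreover have "mut y b' x t = - b x t - b y x * b y t" "mut y b' y t = b y t" "mut y b' z t = - b z t"
    using dist pq a by (auto simp: mut_def n n' e)
  ultimately show ?thesis
    unfolding state_pair_def m using s dist row_pair_init[OF pq(2) a(1-3) pq(1)] by (auto simp: skew_mut)
qed

text \<open>\<open>x\<close>, \<open>y\<close>, \<open>z\<close> are in turn sources of the triangle
  when they are mutated. Such a mutation applies the transvection to the rest of the row exactly
  when the entry at that vertex is negative; these are the conditions on \<open>ux\<close> and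
  \<open>wz\<close> in \<open>row_link\<close>, while the entry at \<open>y\<close> is always
  negative.\<close>

lemma state_pair_center:
  assumes P: "state_pair x y z t b b'" and pq: "b x y \<ge> 2" "b y z \<ge> 2" "b z x \<le> - 2"
    and u: "u \<in> {x, y, z, t}" "v \<in> {x, y, z, t}"
  shows "fold mut [x, y, z] b u v = b' u v"
proof -
  have s: "skew b" "skew b'" and dist: "distinct [x, y, z, t]" and e: "b' x y = b x y" "b' y z = b y z" "b' z x = b z x"
    and R: "row_pair (b x y) (b y z) (b z x) (b x t) (b y t) (b z t) (b' x t) (b' y t) (b' z t)"
    using P unfolding state_pair_def by auto
  have us: "row_state (b x y) (b y z) (b z x) (b x t) (b y t) (b z t)"
    and rl: "row_link (b x y) (b y z) (b z x) (b x t) (b y t) (b z t) (b' x t) (b' y t) (b' z t)"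
    using R unfolding row_pair_def by auto
  have T: "triangle (b x y) (b y z) (b z x)" using pq unfolding triangle_def by auto
  define vy where "vy = b y t + (if b x t < 0 then b x t * b x y else 0)"
  define vz where "vz = b z t - (if b x t < 0 then b x t * b z x else 0)"
  have vy: "vy < 0"
    using row_state_center(3)[OF us pq] row_state_bounds(1,4)[OF T us] unfolding vy_def by (auto simp: mult.commute)
  have rl': "b' y t + (if b' z t > 0 then b' z t * b y z else 0) = - vy"
    "b' x t - (if b' z t > 0 then b' z t * b z x else 0) = - b x t + vy * b x y"
    "b' z t = - vz - vy * b y z"
    using rl unfolding row_link_def vy_def vz_def Let_def by auto
  define b1 where "b1 = mut x b"
  define b2 where "b2 = mut y b1"
  define b3 where "b3 = mut z b2"
  have sk: "skew b1" "skew b2" "skew b3" unfolding b1_def b2_def b3_def using s by (auto intro: skew_mut)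
  have n: "b t x = - b x t" "b x z = - b z x" "b y x = - b x y" "b z y = - b y z" by (rule skewD[OF s(1)])+
  have n1: "b1 t y = - b1 y t" "b1 x z = - b1 z x" "b1 y x = - b1 x y" "b1 z y = - b1 y z" by (rule skewD[OF sk(1)])+
  have n2: "b2 t z = - b2 z t" "b2 x z = - b2 z x" "b2 y x = - b2 x y" "b2 z y = - b2 y z" by (rule skewD[OF sk(2)])+
  have 1: "b1 x y = - b x y" "b1 z x = - b z x" "b1 y z = b y z" "b1 x t = - b x t" "b1 y t = vy" "b1 z t = vz"
    using dist pq unfolding b1_def vy_def vz_def by (auto simp: mut_def n)
  have 2: "b2 x y = b x y" "b2 z x = - b z x" "b2 y z = - b y z" "b2 x t = - b x t + b x y * vy" "b2 y t = - vy"
    "b2 z t = - b' z t"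
    using dist pq vy rl'(3) unfolding b2_def by (auto simp: mut_def n1 1 mult.commute)
  have 3: "b3 x y = b x y" "b3 z x = b z x" "b3 y z = b y z" "b3 x t = b' x t" "b3 y t = b' y t" "b3 z t = b' z t"
    using dist pq rl'(1,2) unfolding b3_def by (auto simp: mut_def n2 2 mult.commute)
  have m3: "b3 v u = - b3 u v" for u v by (rule skewD[OF sk(3)])
  have m: "b' v u = - b' u v" for u v by (rule skewD[OF s(2)])
  have "b3 u v = b' u v"
    using u 3 e skew_diag[OF s(2)] skew_diag[OF sk(3)] m3[of x y] m3[of z x] m3[of y z] m3[of x t] m3[of y t] m3[of z t]
     m[of x y] m[of z x] m[of y z] m[of x t] m[of y t] m[of z t] by auto
  then show ?thesis unfolding b3_def b2_def b1_def by simp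
qed

section \<open>The descent to the acyclic centre\<close>

text \<open>Matrices are total functions; agreement on \<open>V\<close> yields equality only if both
  vanish elsewhere.\<close>

definition supported :: "'a set \<Rightarrow> ('a \<Rightarrow> 'a \<Rightarrow> int) \<Rightarrow> bool" where
  "supported V b \<longleftrightarrow> (\<forall>u v. u \<notin> V \<or> v \<notin> V \<longrightarrow> b u v = 0)"

lemma supported_mut: assumes "supported V b" shows "supported V (mut i b)"
proof -
  have z: "u \<notin> V \<Longrightarrow> b u v = 0" "v \<notin> V \<Longrightarrow> b u v = 0" for u v
    using assms unfolding supported_def by blast+
  have "mut i b u v = 0" if "u \<notin> V \<or> v \<notin> V" for u v
    using that by (elim disjE) (simp_all add: mut_def z)
  then show ?thesis unfolding supported_def by blast
qed

lemma supported_fold_mut: "supported V b \<Longrightarrow> supported V (fold mut xs b)"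
  by (induction xs arbitrary: b) (auto simp: supported_mut)

lemma supported_eqI: "supported V b \<Longrightarrow> supported V b' \<Longrightarrow> (\<And>u v. u \<in> V \<Longrightarrow> v \<in> V \<Longrightarrow> b u v = b' u v) \<Longrightarrow> b = b'"
  unfolding supported_def by (intro ext) metis

definition ascending_except :: "'a set \<Rightarrow> ('a \<Rightarrow> 'a \<Rightarrow> int) \<Rightarrow> 'a \<Rightarrow> 'a \<Rightarrow> bool" where
  "ascending_except V b i j \<longleftrightarrow> (\<forall>k\<in>V - {i, j}. ascending V b k)"

lemma ascending_except_commute: "ascending_except V b i j \<longleftrightarrow> ascending_except V b j i"
  unfolding ascending_except_def by (simp add: insert_commute)

lemma ascending_except_uminus: "skew b \<Longrightarrow> ascending_except V (- b) i j \<Longrightarrow> ascending_except V b i j"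
  using ascending_uminus[of "- b" V] skew_uminus[of b] unfolding ascending_except_def uminus_uminus_matrix by blast

text \<open>\<open>tight_path V b a xs\<close>: starting at \<open>b\<close>, which was reached by mutating at \<open>a\<close>, follow \<open>xs\<close>.\<close>

primrec tight_path :: "'a set \<Rightarrow> ('a \<Rightarrow> 'a \<Rightarrow> int) \<Rightarrow> 'a \<Rightarrow> 'a list \<Rightarrow> bool" where
  "tight_path V b a [] \<longleftrightarrow> True"
| "tight_path V b a (x # xs) \<longleftrightarrow> ascending_except V b a x \<and> tight_path V (mut x b) x xs"

lemma tight_path_append: "tight_path V b a (xs @ ys) \<longleftrightarrow> tight_path V b a xs \<and> tight_path V (fold mut xs b) (last (a # xs)) ys"
  by (induction xs arbitrary: a b) auto

text \<open>Backwards, every matrix keeps its two adjacent labels, and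
  \<open>ascending_except\<close> is symmetric in them. The label \<open>a\<close> of arrival
  becomes the final step.\<close>

lemma tight_path_rev:
  assumes "skew b" "tight_path V b a (xs @ [z])" shows "tight_path V (fold mut xs b) z (rev xs @ [a])"
  using assms
proof (induction xs arbitrary: a b)
  case Nil then show ?case using ascending_except_commute by fastforce
next
  case (Cons x xs)
  have 1: "ascending_except V b a x" "tight_path V (mut x b) x (xs @ [z])" using Cons.prems by auto
  have 2: "tight_path V (fold mut xs (mut x b)) z (rev xs @ [x])"
    by (rule Cons.IH[OF skew_mut[OF Cons.prems(1)] 1(2)])
  have 3: "fold mut (rev xs @ [x]) (fold mut (x # xs) b) = b"
    using fold_mut_rev[OF Cons.prems(1), of "x # xs"] by simp
  have "tight_path V (fold mut (rev xs @ [x]) (fold mut (x # xs) b)) (last (z # rev xs @ [x])) [a]"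
    unfolding 3 using 1(1) ascending_except_commute by fastforce
  then show ?case using 2 tight_path_append[of V "fold mut (x # xs) b" z "rev xs @ [x]" "[a]"] by simp
qed

text \<open>\<open>s\<close> is opposite to the heaviest edge. The margin 2 arises at the centre,
  where \<open>p * q \<ge> p + q\<close> and the third edge adds at least 2. It persists because the
  next heaviest edge is at least twice the old one minus one of the lighter edges.\<close>

definition descending :: "'a set \<Rightarrow> ('a \<Rightarrow> 'a \<Rightarrow> int) \<Rightarrow> 'a \<Rightarrow> bool" where
  "descending W b s \<longleftrightarrow> (\<exists>x z. W = {x, s, z} \<and> distinct [x, s, z] \<and> b x s \<ge> 2 \<and> b s z \<ge> 2 \<and>
     b z x \<ge> b x s + b s z + 2)"

lemma descending_center:
  assumes s: "skew b" and d: "distinct [x, y, z]" and pq: "b x y \<ge> 2" "b y z \<ge> 2" "b z x \<le> - 2"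
  shows "descending {x, y, z} (mut y b) y"
proof -
  have n: "b y x = - b x y" "b z y = - b y z" "b x z = - b z x" by (rule skewD[OF s])+
  have m: "mut y b z y = b y z" "mut y b y x = b x y" "mut y b x z = b x y * b y z - b z x"
    using d pq by (auto simp: mut_def n)
  have "mut y b x z \<ge> mut y b z y + mut y b y x + 2"
    unfolding m using two_le_mult[OF pq(1,2)] pq by linarith
  then show ?thesis unfolding descending_def using d pq m
    by (intro exI[of _ z] exI[of _ x]) auto
qed

lemma descending_mut:
  assumes s: "skew b" and d: "descending W b y" and y': "y' \<in> W" "y' \<noteq> y"
  shows "descending W (mut y' b) y'"
proof -
  obtain x z where W: "W = {x, y, z}" and dist: "distinct [x, y, z]" and
    b: "b x y \<ge> 2" "b y z \<ge> 2" "b z x \<ge> b x y + b y z + 2" using d unfolding descending_def by auto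
  have n: "b y x = - b x y" "b z y = - b y z" "b x z = - b z x" by (rule skewD[OF s])+
  have zx: "b z x \<ge> 2" using b by linarith
  have ne: "x \<noteq> y" "y \<noteq> x" "x \<noteq> z" "z \<noteq> x" "y \<noteq> z" "z \<noteq> y" using dist by auto
  consider "y' = x" | "y' = z" using y' W by auto
  then show ?thesis
  proof cases
    case 1
    have m: "mut x b y x = b x y" "mut x b x z = b z x" "mut x b z y = b x y * b z x - b y z"
      using ne b(1,2) zx by (simp_all add: mut_def n)
    have "mut x b z y \<ge> mut x b y x + mut x b x z + 2"
      unfolding m using two_le_mult[OF b(1) zx] b by linarith
    moreover have "W = {y, x, z}" "distinct [y, x, z]" using W dist by auto
    ultimately show ?thesis unfolding descending_def 1 using b(1) zx m(1,2) by metis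
  next
    case 2
    have m: "mut z b x z = b z x" "mut z b z y = b y z" "mut z b y x = b y z * b z x - b x y"
      using ne b(1,2) zx by (simp_all add: mut_def n)
    have "mut z b y x \<ge> mut z b x z + mut z b z y + 2"
      unfolding m using two_le_mult[OF b(2) zx] b by linarith
    moreover have "W = {x, z, y}" "distinct [x, z, y]" using W dist by auto
    ultimately show ?thesis unfolding descending_def 2 using b(2) zx m(1,2) by metis
  qed
qed

lemma ascending_except_init:
  assumes s: "skew b" and d: "descending W b y" and t: "t \<notin> W" and a: "\<forall>h\<in>W. b h t \<ge> 2"
  shows "ascending_except (insert t W) b t y"
proof -
  obtain x z where W: "W = {x, y, z}" and dist: "distinct [x, y, z]" and
    b: "b x y \<ge> 2" "b y z \<ge> 2" "b z x \<ge> b x y + b y z + 2" using d unfolding descending_def by auto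
  have n: "b y x = - b x y" "b z y = - b y z" "b x z = - b z x" by (rule skewD[OF s])+
  have "ascending (insert t W) b x"
    apply (rule ascending_four[OF s, of _ x y z t])
    using W a b unfolding n undominated_def by auto
  moreover have "ascending (insert t W) b z"
    apply (rule ascending_four[OF s, of _ z x y t])
    using W a b unfolding n undominated_def by auto
  ultimately show ?thesis unfolding ascending_except_def W by auto
qed

lemma ascending_except_acyclic:
  assumes s: "skew b" and V: "V = {a, c, d, e}"
    and b: "b a c \<ge> 2" "b a d \<ge> 2" "b a e \<ge> 2" "b c d \<ge> 2" "b c e \<ge> 2" "b d e \<ge> 2"
  shows "ascending_except V b a e"
proof -
  have n: "b c a = - b a c" "b d a = - b a d" "b d c = - b c d" by (rule skewD[OF s])+
  have "ascending V b c" apply (rule ascending_four[OF s, of _ c a d e]) using V b unfolding n undominated_def by auto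
  moreover have "ascending V b d" apply (rule ascending_four[OF s, of _ d a c e]) using V b unfolding n undominated_def by auto
  ultimately show ?thesis unfolding ascending_except_def V by auto
qed

lemma descending_agree:
  assumes "descending W b s" "\<forall>u\<in>W. \<forall>v\<in>W. b' u v = b u v" shows "descending W b' s"
proof -
  obtain x z where X: "W = {x, s, z}" "distinct [x, s, z]" "b x s \<ge> 2" "b s z \<ge> 2" "b z x \<ge> b x s + b s z + 2"
    using assms(1) unfolding descending_def by auto
  moreover have "b' x s = b x s" "b' s z = b s z" "b' z x = b z x" using assms(2) X(1) by auto
  ultimately show ?thesis unfolding descending_def by metis
qed

section \<open>Descending along the mutation sequence from both ends\<close>

locale rank3 =
  fixes H :: "'a \<Rightarrow> 'a \<Rightarrow> int" and v1 v2 v3 :: 'a and W :: "'a set"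
  assumes skew_H: "skew H" and dist: "distinct [v1, v2, v3]" and W: "W = {v1, v2, v3}"
    and H: "H v1 v2 \<ge> 2" "H v2 v3 \<ge> 2" "H v3 v1 \<le> - 2"
begin

lemma descending_fold:
  assumes "M \<noteq> []" "distinct_adj M" "set M \<subseteq> W" "hd M = v2"
  shows "descending W (fold mut M H) (last M)"
  using assms
proof (induction M rule: rev_induct)
  case (snoc y M)
  show ?case
  proof (cases "M = []")
    case True
    then show ?thesis using snoc.prems descending_center[OF skew_H dist H] W by simp
  next
    case False
    have "descending W (fold mut M H) (last M)"
      using False snoc.prems by (intro snoc.IH) (auto simp: distinct_adj_append_iff)
    moreover have "y \<in> W" "y \<noteq> last M"
      using snoc.prems False by (auto simp: distinct_adj_append_iff)
    ultimately show ?thesis using descending_mut skew_fold_mut[OF skew_H] by fastforce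
  qed
qed simp

end

text \<open>\<open>c\<close> and \<open>c'\<close> are the two ends: both carry the triangle reached
  from \<open>H\<close> along \<open>M\<close>, and \<open>t\<close> is a sink in \<open>c\<close>
  and a source in \<open>c'\<close>.\<close>

locale rank3_pair = rank3 +
  fixes M :: "'a list" and t :: 'a and c c' :: "'a \<Rightarrow> 'a \<Rightarrow> int" and V :: "'a set"
  assumes M: "M \<noteq> []" "distinct_adj M" "set M \<subseteq> W" "hd M = v2"
    and t: "t \<notin> W" and V: "V = insert t W"
    and sc: "skew c" "skew c'"
    and agree: "\<forall>u\<in>W. \<forall>v\<in>W. c u v = fold mut M H u v" "\<forall>u\<in>W. \<forall>v\<in>W. c' u v = fold mut M H u v"
    and a: "\<forall>h\<in>W. c h t \<ge> 2" "\<forall>h\<in>W. c' h t = - c h t"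
begin

lemma agree_fold:
  assumes "M = N @ R"
  shows "\<forall>u\<in>W. \<forall>v\<in>W. fold mut (rev R) c u v = fold mut N H u v"
    "\<forall>u\<in>W. \<forall>v\<in>W. fold mut (rev R) c' u v = fold mut N H u v"
proof -
  have R: "set (rev R) \<subseteq> W" using M(3) assms by auto
  have e: "fold mut (rev R) (fold mut M H) = fold mut N H"
    unfolding assms using fold_mut_rev[OF skew_fold_mut[OF skew_H]] by simp
  show "\<forall>u\<in>W. \<forall>v\<in>W. fold mut (rev R) c u v = fold mut N H u v"
    "\<forall>u\<in>W. \<forall>v\<in>W. fold mut (rev R) c' u v = fold mut N H u v"
    using fold_mut_agree[OF agree(1) R] fold_mut_agree[OF agree(2) R] unfolding e .
qed

lemma descending_prefix:
  assumes "M = N @ R" "N \<noteq> []" shows "descending W (fold mut N H) (last N)"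
proof (rule descending_fold[OF assms(2)])
  show "distinct_adj N" using M(2) unfolding assms(1) by (simp add: distinct_adj_append_iff)
  show "set N \<subseteq> W" using M(3) unfolding assms(1) by simp
  show "hd N = v2" using M(4) assms(2) unfolding assms(1) by simp
qed

text \<open>The orientation \<open>x \<rightarrow> y \<rightarrow> z\<close> after \<open>N\<close>
  is carried along because the next vertex to be undone is known only as the
  \<open>descending\<close> one. Comparing the two orientations identifies its neighbours and
  supplies the heaviest-edge inequality for the step.\<close>

lemma state_pair_descent:
  assumes "M = N @ y # R"
  shows "\<exists>x z. W = {x, y, z} \<and> state_pair x y z t (fold mut (rev (y # R)) c) (fold mut (rev (y # R)) c') \<and>
    fold mut N H x y \<ge> 2 \<and> fold mut N H y z \<ge> 2"
  using assms
proof (induction R arbitrary: N y)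
  case Nil
  let ?b = "fold mut M H"
  have b: "?b = mut y (fold mut N H)" using Nil by simp
  have s: "skew ?b" by (rule skew_fold_mut[OF skew_H])
  have N: "fold mut N H = mut y ?b" using mut_mut[OF skew_fold_mut[OF skew_H], of y N] b by simp
  have "descending W ?b y" using descending_prefix[of M "[]"] Nil M(1) by simp
  then obtain x z where X: "W = {x, y, z}" "distinct [x, y, z]" "?b x y \<ge> 2" "?b y z \<ge> 2"
      "?b z x \<ge> ?b x y + ?b y z + 2"
    unfolding descending_def by auto
  have "state_pair z y x t (mut y c) (mut y c')"
    using X t agree a by (intro state_pair_init sc) auto
  moreover have "fold mut N H z y \<ge> 2" "fold mut N H y x \<ge> 2"
    using X skewD[OF s, of y z] skewD[OF s, of x y] unfolding N by (auto simp: mut_def)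
  moreover have "W = {z, y, x}" using X by auto
  ultimately show ?case by auto
next
  case (Cons y' R)
  let ?b = "fold mut (rev (y' # R)) c" and ?b' = "fold mut (rev (y' # R)) c'" and ?h = "fold mut (N @ [y]) H"
  have M': "M = (N @ [y]) @ y' # R" using Cons.prems by simp
  obtain x z where X: "W = {x, y', z}" "state_pair x y' z t ?b ?b'" "?h x y' \<ge> 2" "?h y' z \<ge> 2"
    using Cons.IH[OF M'] by blast
  have s: "skew ?h" by (rule skew_fold_mut[OF skew_H])
  have sN: "skew (fold mut N H)" by (rule skew_fold_mut[OF skew_H])
  have N: "fold mut N H = mut y ?h" using mut_mut[OF sN, of y] by simp
  have e: "?b u v = ?h u v" if "u \<in> W" "v \<in> W" for u v using agree_fold(1)[OF M'] that by blast
  obtain x0 z0 where D: "W = {x0, y, z0}" "distinct [x0, y, z0]" "?h x0 y \<ge> 2" "?h y z0 \<ge> 2"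
      "?h z0 x0 \<ge> ?h x0 y + ?h y z0 + 2"
    using descending_prefix[OF M'] unfolding descending_def by auto
  have y: "y \<noteq> y'" "y \<in> W" using M(2,3) unfolding Cons.prems by (auto simp: distinct_adj_append_iff)
  have sk: "?h v u = - ?h u v" for u v by (rule skewD[OF s])
  have in_W: "x0 \<in> W" "z0 \<in> W" using D(1) by blast+
  consider "y = x" | "y = z" using y X(1) by blast
  then show ?case
  proof cases
    case 1
    have "x0 \<in> {y', z}" "z0 \<in> {y', z}" "x0 \<noteq> z0" using in_W D(2) X(1) 1 by auto
    moreover have "x0 \<noteq> y'" using D(3) X(3) sk[of x y'] 1 by auto
    ultimately have x0: "x0 = z" "z0 = y'" by auto
    have P: "state_pair y' x z t (mut x ?b) (mut x ?b')"
      using D(3-5) e X(1) unfolding x0 1 by (intro state_pair_step[OF X(2)]) auto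
    have "fold mut N H y' x \<ge> 2" "fold mut N H x z \<ge> 2"
      unfolding N 1 using D(3,4) sk[of x y'] sk[of z x] unfolding x0 1 by (auto simp: mut_def)
    moreover have "W = {y', x, z}" using X(1) by auto
    ultimately show ?thesis using P unfolding 1 by auto
  next
    case 2
    have "x0 \<in> {y', x}" "z0 \<in> {y', x}" "x0 \<noteq> z0" using in_W D(2) X(1) 2 by auto
    moreover have "z0 \<noteq> y'" using D(4) X(4) sk[of z y'] 2 by auto
    ultimately have x0: "x0 = y'" "z0 = x" by auto
    have P: "state_pair x z y' t (mut z ?b) (mut z ?b')"
      using D(3-5) e X(1) unfolding x0 2 by (intro state_pair_step'[OF X(2)]) auto
    have "fold mut N H x z \<ge> 2" "fold mut N H z y' \<ge> 2"
      unfolding N 2 using D(3,4) sk[of y' z] sk[of z x] unfolding x0 2 by (auto simp: mut_def)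
    moreover have "W = {x, z, y'}" using X(1) by auto
    ultimately show ?thesis using P unfolding 2 by auto
  qed
qed

text \<open>Besides \<open>t\<close>, one vertex has to ascend, namely the one of \<open>x\<close>,
  \<open>z\<close> that is not \<open>s\<close>. On the opposite of the second matrix these two
  trade places, so where \<open>ascending_z\<close> serves one end, \<open>ascending_x\<close>
  serves the other.\<close>

lemma ascending_except_descent:
  assumes "M = N @ s # y # R"
  shows "ascending_except V (fold mut (rev (y # R)) c) y s" "ascending_except V (fold mut (rev (y # R)) c') y s"
proof -
  let ?b = "fold mut (rev (y # R)) c" and ?b' = "fold mut (rev (y # R)) c'" and ?h = "fold mut (N @ [s]) H"
  have M': "M = (N @ [s]) @ y # R" using assms by simp
  obtain x z where X: "W = {x, y, z}" "state_pair x y z t ?b ?b'" "?h x y \<ge> 2" "?h y z \<ge> 2"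
    using state_pair_descent[OF M'] by blast
  have sh: "skew ?h" by (rule skew_fold_mut[OF skew_H])
  have sk: "?h v u = - ?h u v" for u v by (rule skewD[OF sh])
  have e: "?b u v = ?h u v" "?b' u v = ?h u v" if "u \<in> W" "v \<in> W" for u v
    using agree_fold[OF M'] that by blast+
  have sb: "skew ?b" "skew ?b'" and u: "row_state (?b x y) (?b y z) (?b z x) (?b x t) (?b y t) (?b z t)"
    and w: "row_state (?b y z) (?b x y) (?b z x) (- ?b' z t) (- ?b' y t) (- ?b' x t)"
    using X(2) unfolding state_pair_def row_pair_def by auto
  have sb': "skew (- ?b')" by (rule skew_uminus[OF sb(2)])
  have n: "(- ?b') z y = ?h y z" "(- ?b') y x = ?h x y" "(- ?b') x z = ?h z x"
    using e X(1) sk[of z y] sk[of y x] sk[of x z] by auto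
  have n': "?b y z = ?h y z" "?b x y = ?h x y" "?b z x = ?h z x" using e X(1) by auto
  have w': "row_state ((- ?b') z y) ((- ?b') y x) ((- ?b') x z) ((- ?b') z t) ((- ?b') y t) ((- ?b') x t)"
    using w unfolding n n' by simp
  have V': "V = {x, y, z, t}" "V = {z, y, x, t}" using V X(1) by auto
  obtain x0 z0 where D: "W = {x0, s, z0}" "distinct [x0, s, z0]" "?h x0 s \<ge> 2" "?h s z0 \<ge> 2"
      "?h z0 x0 \<ge> ?h x0 s + ?h s z0 + 2"
    using descending_prefix[OF M'] unfolding descending_def by auto
  have s: "s \<noteq> y" "s \<in> W" using M(2,3) unfolding assms by (auto simp: distinct_adj_append_iff)
  have in_W: "x0 \<in> W" "z0 \<in> W" using D(1) by blast+
  consider "s = x" | "s = z" using s X(1) by blast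
  then have "ascending_except V ?b y s \<and> ascending_except V (- ?b') y s"
  proof cases
    case 1
    have "x0 \<in> {y, z}" "z0 \<in> {y, z}" "x0 \<noteq> z0" using in_W D(2) X(1) 1 by auto
    moreover have "x0 \<noteq> y" using D(3) X(3) sk[of x y] 1 by auto
    ultimately have x0: "x0 = z" "z0 = y" by auto
    have q: "?h z x \<ge> 2" "?h x y \<ge> 2" "?h y z \<ge> ?h z x + ?h x y + 2" using D(3-5) unfolding x0 1 .
    have T: "triangle (?b x y) (?b y z) (?b z x)" "triangle ((- ?b') z y) ((- ?b') y x) ((- ?b') x z)"
      unfolding n n' using q unfolding triangle_def by auto
    have "ascending V ?b t" by (rule ascending_t[OF sb(1) V'(1) T(1) u])
    moreover have "ascending V ?b z"
      using q n' by (intro ascending_z[OF sb(1) V'(1) T(1) u]) linarith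
    moreover have "ascending V (- ?b') t" by (rule ascending_t[OF sb' V'(2) T(2) w'])
    moreover have "ascending V (- ?b') z"
      using q by (intro ascending_x[OF sb' V'(2) T(2) w']) (unfold n, linarith+)
    ultimately show ?thesis unfolding ascending_except_def V'(1) 1 by auto
  next
    case 2
    have "x0 \<in> {y, x}" "z0 \<in> {y, x}" "x0 \<noteq> z0" using in_W D(2) X(1) 2 by auto
    moreover have "z0 \<noteq> y" using D(4) X(4) sk[of z y] 2 by auto
    ultimately have x0: "x0 = y" "z0 = x" by auto
    have q: "?h y z \<ge> 2" "?h z x \<ge> 2" "?h x y \<ge> ?h y z + ?h z x + 2" using D(3-5) unfolding x0 2 .
    have T: "triangle (?b x y) (?b y z) (?b z x)" "triangle ((- ?b') z y) ((- ?b') y x) ((- ?b') x z)"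
      unfolding n n' using q unfolding triangle_def by auto
    have "ascending V ?b t" by (rule ascending_t[OF sb(1) V'(1) T(1) u])
    moreover have "ascending V ?b x"
      using q n' by (intro ascending_x[OF sb(1) V'(1) T(1) u]) linarith+
    moreover have "ascending V (- ?b') t" by (rule ascending_t[OF sb' V'(2) T(2) w'])
    moreover have "ascending V (- ?b') x"
      using q by (intro ascending_z[OF sb' V'(2) T(2) w']) (unfold n, linarith)
    ultimately show ?thesis unfolding ascending_except_def V'(1) 2 by auto
  qed
  then show "ascending_except V ?b y s" "ascending_except V ?b' y s" using ascending_except_uminus[OF sb(2)] by blast+
qed

lemma state_pair_final: "state_pair v1 v2 v3 t (fold mut (rev M) c) (fold mut (rev M) c')"
proof -
  obtain R where R: "M = [] @ v2 # R" using M(1,4) by (cases M) auto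
  obtain x z where X: "W = {x, v2, z}" "state_pair x v2 z t (fold mut (rev M) c) (fold mut (rev M) c')"
    "H x v2 \<ge> 2" "H v2 z \<ge> 2" using state_pair_descent[OF R] unfolding R by auto
  have "x \<in> W" "z \<in> W" using X by auto
  then have "x = v1" "z = v3"
    using W X(3,4) H skewD[OF skew_H, of v2 v3] skewD[OF skew_H, of v1 v2] skew_diag[OF skew_H, of v2] by auto
  then show ?thesis using X(2) by simp
qed

lemma H_final:
  assumes "u \<in> W" "v \<in> W" shows "fold mut (rev M) c u v = H u v" "fold mut (rev M) c' u v = H u v"
  using agree_fold[of "[]" M] assms by auto

text \<open>These are the four quivers met while mutating at \<open>v1, v2, v3\<close>: two seen
  from the side of \<open>c\<close>, the other two from the side of \<open>c'\<close>, where
  reversal turns the sink \<open>v3\<close> into the source.\<close>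

lemma ascending_except_final:
  shows "ascending_except V (fold mut (rev M) c) v2 v1" "ascending_except V (mut v1 (fold mut (rev M) c)) v1 v2"
    "ascending_except V (fold mut (rev M) c') v2 v3" "ascending_except V (mut v3 (fold mut (rev M) c')) v3 v2"
proof -
  let ?b = "fold mut (rev M) c" and ?b' = "fold mut (rev M) c'"
  have sb: "skew ?b" "skew ?b'" using sc skew_fold_mut by blast+
  have e: "?b v1 v2 = H v1 v2" "?b v2 v3 = H v2 v3" "?b v3 v1 = H v3 v1" using H_final W by auto
  have u: "row_state (?b v1 v2) (?b v2 v3) (?b v3 v1) (?b v1 t) (?b v2 t) (?b v3 t)"
    and w: "row_state (?b v2 v3) (?b v1 v2) (?b v3 v1) (- ?b' v3 t) (- ?b' v2 t) (- ?b' v1 t)"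
    using state_pair_final unfolding state_pair_def row_pair_def by auto
  have sb': "skew (- ?b')" by (rule skew_uminus[OF sb(2)])
  have n: "(- ?b') v3 v2 = ?b v2 v3" "(- ?b') v2 v1 = ?b v1 v2" "(- ?b') v1 v3 = ?b v3 v1"
    using H_final W skewD[OF skew_H, of v2 v3] skewD[OF skew_H, of v1 v2] skewD[OF skew_H, of v3 v1] by auto
  have w': "row_state ((- ?b') v3 v2) ((- ?b') v2 v1) ((- ?b') v1 v3) ((- ?b') v3 t) ((- ?b') v2 t) ((- ?b') v1 t)"
    using w unfolding n by simp
  have T: "triangle (?b v1 v2) (?b v2 v3) (?b v3 v1)" "triangle ((- ?b') v3 v2) ((- ?b') v2 v1) ((- ?b') v1 v3)"
    unfolding n e triangle_def using H by auto
  have V': "V = {v1, v2, v3, t}" "V = {v3, v2, v1, t}" using V W by auto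
  have d4: "distinct [v1, v2, v3, t]" "distinct [v3, v2, v1, t]" using dist t W by auto
  have c: "?b v3 v1 \<le> - 2" "(- ?b') v1 v3 \<le> - 2" "?b v1 v2 \<ge> 2" "?b v2 v3 \<ge> 2" "(- ?b') v3 v2 \<ge> 2" "(- ?b') v2 v1 \<ge> 2"
    unfolding n e using H by auto
  have "ascending V ?b t" "ascending V ?b v3"
    using ascending_t[OF sb(1) V'(1) T(1) u] ascending_z[OF sb(1) V'(1) T(1) u] c by auto
  then show "ascending_except V ?b v2 v1" unfolding ascending_except_def V'(1) by auto
  show "ascending_except V (mut v1 ?b) v1 v2"
    using ascending_after_source[OF sb(1) V'(1) d4(1) c(3,4,1) u] unfolding ascending_except_def V'(1) by auto
  have "ascending V (- ?b') t" by (rule ascending_t[OF sb' V'(2) T(2) w'])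
  moreover have "ascending V (- ?b') v1" by (rule ascending_z[OF sb' V'(2) T(2) w' disjI1[OF c(2)]])
  ultimately have "ascending_except V (- ?b') v2 v3" unfolding ascending_except_def V'(1) by blast
  then show "ascending_except V ?b' v2 v3" by (rule ascending_except_uminus[OF sb(2)])
  have "ascending_except V (mut v3 (- ?b')) v3 v2"
    using ascending_after_source[OF sb' V'(2) d4(2) c(5,6,2) w'] unfolding ascending_except_def V'(1)
    by (metis DiffE insertCI insertE singletonD)
  then show "ascending_except V (mut v3 ?b') v3 v2"
    unfolding mut_uminus by (rule ascending_except_uminus[OF skew_mut[OF sb(2)]])
qed

lemma tight_path_descent:
  shows "M = N @ y # R \<Longrightarrow> tight_path V (fold mut (rev (y # R)) c) y (rev N @ [v1])"
    "M = N @ y # R \<Longrightarrow> tight_path V (fold mut (rev (y # R)) c') y (rev N @ [v3])"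
proof (induction N arbitrary: y R rule: rev_induct)
  case Nil
  { case 1 then show ?case using ascending_except_final(1) M(4) by simp }
  { case 2 then show ?case using ascending_except_final(3) M(4) by simp }
next
  case (snoc s N)
  { case 1
    then have "tight_path V (fold mut (rev (s # y # R)) c) s (rev N @ [v1])" by (intro snoc.IH(1)) simp
    then show ?case using ascending_except_descent(1)[of N s y R] 1 by simp }
  { case 2
    then have "tight_path V (fold mut (rev (s # y # R)) c') s (rev N @ [v3])" by (intro snoc.IH(2)) simp
    then show ?case using ascending_except_descent(2)[of N s y R] 2 by simp }
qed

lemma ascending_except_top: "ascending_except V c t (last M)" "ascending_except V c' t (last M)"
proof -
  have b: "descending W (fold mut M H) (last M)" using descending_prefix[of M "[]"] M by simp
  have s: "skew (fold mut M H)" by (rule skew_fold_mut[OF skew_H])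
  have y: "last M \<in> W" using M by auto
  have d: "descending W c (last M)" by (rule descending_agree[OF b agree(1)])
  then show "ascending_except V c t (last M)" unfolding V using a(1) t by (intro ascending_except_init sc)
  obtain x z where X: "W = {x, last M, z}" "distinct [x, last M, z]" "c' x (last M) \<ge> 2" "c' (last M) z \<ge> 2"
      "c' z x \<ge> c' x (last M) + c' (last M) z + 2"
    using descending_agree[OF b agree(2)] unfolding descending_def by auto
  have "W = {z, last M, x}" "distinct [z, last M, x]" using X(1,2) by auto
  moreover have "(- c') z (last M) = c' (last M) z" "(- c') (last M) x = c' x (last M)" "(- c') x z = c' z x"
    using skewD[OF sc(2), of z "last M"] skewD[OF sc(2), of "last M" x] skewD[OF sc(2), of x z] by simp_all
  ultimately have "descending W (- c') (last M)" unfolding descending_def using X(3-5) by (metis add.commute)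
  moreover have "\<forall>h\<in>W. (- c') h t \<ge> 2" using a by auto
  ultimately have "ascending_except V (- c') t (last M)" unfolding V using t by (intro ascending_except_init skew_uminus sc)
  then show "ascending_except V c' t (last M)" by (rule ascending_except_uminus[OF sc(2)])
qed

lemma tight_path_top: "tight_path V c t (rev M @ [v1])" "tight_path V c' t (rev M @ [v3])"
proof -
  obtain N y where N: "M = N @ y # []" using M(1) by (metis rev_exhaust)
  show "tight_path V c t (rev M @ [v1])" "tight_path V c' t (rev M @ [v3])"
    using tight_path_descent[OF N] ascending_except_top unfolding N by auto
qed

lemma source_rotation:
  assumes "supported V c" "supported V c'"
  shows "fold mut [v1, v2, v3] (fold mut (rev M) c) = fold mut (rev M) c'"
proof (rule supported_eqI)
  show "supported V (fold mut [v1, v2, v3] (fold mut (rev M) c))" "supported V (fold mut (rev M) c')"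
    using assms supported_fold_mut by blast+
  fix u v assume "u \<in> V" "v \<in> V"
  then show "fold mut [v1, v2, v3] (fold mut (rev M) c) u v = fold mut (rev M) c' u v"
    using H_final[of v1 v2] H_final[of v2 v3] H_final[of v3 v1] H
    by (intro state_pair_center[OF state_pair_final]) (auto simp: V W)
qed

lemma cycle:
  assumes "supported V c" "supported V c'" "mut t c' = c"
  shows "fold mut (t # rev M @ [v1, v2, v3] @ M) c' = c'"
    "tight_path V c' (last M) (t # rev M @ [v1, v2, v3] @ M)"
proof -
  let ?u = "fold mut (rev M) c" and ?w = "fold mut (rev M) c'"
  have rot: "fold mut [v1, v2, v3] ?u = ?w" by (rule source_rotation[OF assms(1,2)])
  have up_again: "fold mut M ?w = c'" using fold_mut_rev[OF sc(2), of "rev M"] by simp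
  show "fold mut (t # rev M @ [v1, v2, v3] @ M) c' = c'"
    using rot up_again assms(3) by simp
  have su: "skew ?u" using sc skew_fold_mut by blast
  \<comment> \<open>The quiver after \<open>v1, v2\<close> is reached from the side of
    \<open>c'\<close> by undoing \<open>v3\<close>.\<close>
  have w3: "mut v2 (mut v1 ?u) = mut v3 ?w"
    using rot mut_mut[OF skew_mut[OF skew_mut[OF su]], of v3 v2 v1] by simp
  have "tight_path V ?w v3 (M @ [t])" using tight_path_rev[OF sc(2) tight_path_top(2)] by simp
  then have up: "tight_path V ?w v3 M" unfolding tight_path_append by blast
  have lst: "last (t # rev M) = v2" using M by (simp add: last_rev)
  have mid: "tight_path V ?u v2 ([v1, v2, v3] @ M)"
    using ascending_except_final(1,2) ascending_except_final(4)[folded w3] up rot ascending_except_commute by fastforce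
  have "tight_path V c t (rev M)" using tight_path_top(1) unfolding tight_path_append by blast
  then have "tight_path V c t (rev M @ [v1, v2, v3] @ M)"
    unfolding tight_path_append[of V c t "rev M"] lst using mid by blast
  then show "tight_path V c' (last M) (t # rev M @ [v1, v2, v3] @ M)"
    using assms(3) ascending_except_top(2) ascending_except_commute by fastforce
qed

end

section \<open>Closed walks\<close>

text \<open>With a periodic index over all integers, reversing the walk is a substitution, and
  reducedness also covers the passage through the base point.\<close>

definition walk :: "'a set \<Rightarrow> (int \<Rightarrow> 'a \<Rightarrow> 'a \<Rightarrow> int) \<Rightarrow> (int \<Rightarrow> 'a) \<Rightarrow> int \<Rightarrow> bool" where
  "walk V B y L \<longleftrightarrow> L > 0 \<and> (\<forall>n. skew (B n) \<and> y n \<in> V \<and> B (n + 1) = mut (y n) (B n) \<and> y n \<noteq> y (n + 1) \<and>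
     B (n + L) = B n \<and> y (n + L) = y n)"

lemma walkD:
  assumes "walk V B y L"
  shows "L > 0" "skew (B n)" "y n \<in> V" "B (n + 1) = mut (y n) (B n)" "y n \<noteq> y (n + 1)" "B (n + L) = B n" "y (n + L) = y n"
  using assms unfolding walk_def by blast+

lemma walk_back: assumes "walk V B y L" shows "mut (y n) (B (n + 1)) = B n"
  using mut_mut[OF walkD(2)[OF assms]] walkD(4)[OF assms] by simp

lemma periodic_mult:
  fixes L :: int
  assumes "\<And>n. f (n + L) = f n" shows "f (n + k * L) = f n"
proof -
  have nat: "f (n + int m * L) = f n" for m n
  proof (induction m arbitrary: n)
    case (Suc m)
    have "f (n + int (Suc m) * L) = f ((n + int m * L) + L)" by (simp add: algebra_simps)
    then show ?case using assms Suc by simp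
  qed simp
  show ?thesis
  proof (cases "k \<ge> 0")
    case True then show ?thesis using nat[of n "nat k"] by simp
  next
    case False
    then show ?thesis using nat[of "n + k * L" "nat (- k)"] by (simp add: algebra_simps)
  qed
qed

lemma walk_reverse:
  assumes "walk V B y L" shows "walk V (\<lambda>n. B (- n)) (\<lambda>n. y (- n - 1)) L"
proof -
  note w = walkD[OF assms]
  have "B (- (n + 1)) = mut (y (- n - 1)) (B (- n))" for n
    using walk_back[OF assms, of "- n - 1"] by simp
  moreover have "y (- n - 1) \<noteq> y (- (n + 1) - 1)" for n
  proof -
    have e: "- (n + 1) - 1 + 1 = - n - 1" by simp
    show ?thesis using w(5)[of "- (n + 1) - 1"] unfolding e by (rule not_sym)
  qed
  moreover have "B (- (n + L)) = B (- n)" "y (- (n + L) - 1) = y (- n - 1)" for n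
  proof -
    have e: "- n - L + L = - n" "- (n + L) = - n - L" "- n - L - 1 + L = - n - 1" by simp_all
    show "B (- (n + L)) = B (- n)" "y (- (n + L) - 1) = y (- n - 1)"
      using w(6)[of "- n - L"] w(7)[of "- n - L - 1"] unfolding e by simp_all
  qed
  ultimately show ?thesis using w(1-3) unfolding walk_def by blast
qed

text \<open>After one ascending step all later ones ascend, since each label differs from the
  preceding one. The weight then grows strictly over a whole period, yet has to return to its
  value.\<close>

lemma walk_not_ascending:
  assumes w: "walk V B y L" and V: "card V = 4" shows "\<not> ascending V (B n) (y n)"
proof
  assume g: "ascending V (B n) (y n)"
  note wd = walkD[OF w]
  have f: "finite V" using V card.infinite by fastforce
  have *: "ascending V (B (n + int k)) (y (n + int k)) \<and> weight V (B n) < weight V (B (n + int (Suc k)))" for k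
  proof (induction k)
    case 0
    then show ?case using g weight_less[OF g wd(2) f] wd(4)[of n] by simp
  next
    case (Suc k)
    let ?m = "n + int k"
    have e: "n + int (Suc k) = ?m + 1" "n + int (Suc (Suc k)) = ?m + 1 + 1" by simp_all
    have g': "ascending V (B (?m + 1)) (y (?m + 1))"
      unfolding wd(4)[of ?m] using Suc ascending_mut[OF wd(2) _ V wd(3)] wd(5)[of ?m] by metis
    have "weight V (B (?m + 1)) < weight V (B (?m + 1 + 1))"
      unfolding wd(4)[of "?m + 1"] by (rule weight_less[OF g' wd(2) f])
    then show ?case using g' Suc unfolding e by simp
  qed
  have "n + int (Suc (nat L - 1)) = n + L" using wd(1) by simp
  then show False using *[of "nat L - 1"] wd(6)[of n] by simp
qed

lemma walk_not_ascending_back: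
  assumes w: "walk V B y L" and V: "card V = 4" shows "\<not> ascending V (B (n + 1)) (y n)"
  using walk_not_ascending[OF walk_reverse[OF w] V, of "- (n + 1)"] by (simp add: add.commute)

section \<open>Closed walks with only two non-ascending directions at each quiver\<close>

locale tight_cycle =
  fixes V :: "'a set" and C :: "int \<Rightarrow> 'a \<Rightarrow> 'a \<Rightarrow> int" and c :: "int \<Rightarrow> 'a" and N :: int and t :: 'a
  assumes V: "card V = 4" and w: "walk V C c N"
    and tight: "\<And>n. ascending_except V (C (n + 1)) (c n) (c (n + 1))"
    and t: "\<And>n. c n = t \<longleftrightarrow> N dvd n"
begin

lemmas wd = walkD[OF w]

text \<open>Tightness is one half. The other holds because the cycle is itself a closed walk, so
  neither the label of departure nor that of arrival ascends. A quiver on the cycle thus determines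
  this pair.\<close>

lemma ascending_iff: "k \<in> V \<Longrightarrow> ascending V (C n) k \<longleftrightarrow> k \<noteq> c (n - 1) \<and> k \<noteq> c n"
  using tight[of "n - 1"] walk_not_ascending[OF w V, of n] walk_not_ascending_back[OF w V, of "n - 1"]
  unfolding ascending_except_def by auto

lemma labels_eq: assumes "C i = C j" shows "{c (i - 1), c i} = {c (j - 1), c j}"
  using ascending_iff[of _ i] ascending_iff[of _ j] wd(3) unfolding assms by blast

lemma adjacent: "c (n - 1) \<noteq> c n" using wd(5)[of "n - 1"] by simp

lemma ex_ascending: "\<exists>k. ascending V (C n) k"
proof -
  have "card (V - {c (n - 1), c n}) \<noteq> 0"
  proof -
    have "card {c (n - 1), c n} \<le> 2" by (simp add: card_insert_if)
    then show ?thesis using V diff_card_le_card_Diff[of "{c (n - 1), c n}" V] by simp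
  qed
  then obtain k where "k \<in> V - {c (n - 1), c n}" by (metis card.empty ex_in_conv)
  then show ?thesis using ascending_iff by blast
qed

lemma C_step_neq: "C (n + 1) \<noteq> C n"
proof
  assume e: "C (n + 1) = C n"
  obtain k where "ascending V (C n) k" using ex_ascending by blast
  then have k: "k \<in> V" "k \<noteq> c n" using ascending_iff unfolding ascending_def by blast+
  have "mut (c n) (C n) (c n) k = C n (c n) k" using e wd(4) by simp
  then have "C n (c n) k = 0" by (simp add: mut_def)
  then show False using ascending_abundant[OF \<open>ascending V (C n) k\<close> wd(3) k(1)] k(2) by fastforce
qed

lemma forward:
  assumes "C i = C j" "c i = c j"
  shows "C (i + int n) = C (j + int n) \<and> c (i + int n) = c (j + int n)"
proof (induction n)
  case (Suc n)
  have 1: "C (i + int n + 1) = C (j + int n + 1)" using Suc wd(4) by simp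
  have "c (i + int n + 1) = c (j + int n + 1)"
    using labels_eq[OF 1] Suc adjacent[of "i + int n + 1"] adjacent[of "j + int n + 1"] by (auto simp: doubleton_eq_iff)
  then show ?case using 1 by (simp add: algebra_simps)
qed (use assms in simp)

lemma backward:
  assumes "C i = C j" "c i = c (j - 1)"
  shows "C (i + int n) = C (j - int n) \<and> c (i + int n) = c (j - 1 - int n)"
proof (induction n)
  case (Suc n)
  have "mut (c (j - 1 - int n)) (C (j - 1 - int n + 1)) = C (j - 1 - int n)" by (rule walk_back[OF w])
  then have 1: "C (i + int n + 1) = C (j - 1 - int n)" using Suc wd(4)[of "i + int n"] by simp
  have "c (i + int n + 1) = c (j - 1 - int n - 1)"
    using labels_eq[OF 1] Suc adjacent[of "i + int n + 1"] adjacent[of "j - 1 - int n"] by (auto simp: doubleton_eq_iff)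
  then show ?case using 1 by (simp add: algebra_simps)
qed (use assms in simp)

text \<open>From two equal quivers the cycle continues either in parallel or in opposite directions.
  In parallel, the steps labelled \<open>t\<close> occur simultaneously, and they sit exactly at the
  multiples of \<open>N\<close>.\<close>

lemma C_inj: assumes "C i = C j" shows "N dvd i - j"
proof -
  consider "c i = c j" | "c i = c (j - 1)" using labels_eq[OF assms] by blast
  then show ?thesis
  proof cases
    case 1
    \<comment> \<open>The least number of steps from \<open>i\<close> to a step labelled
      \<open>t\<close>.\<close>
    define n where "n = nat ((- i) mod N)"
    have "int n = (- i) mod N" using wd(1) unfolding n_def by simp
    then have "N dvd i + int n" by (metis add.commute add.right_inverse dvd_eq_mod_eq_0 mod_add_left_eq mod_0)
    then have "c (j + int n) = t" using forward[OF assms 1, of n] t[of "i + int n"] by simp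
    then have "N dvd j + int n" using t by blast
    then have "N dvd (i + int n) - (j + int n)" using \<open>N dvd i + int n\<close> dvd_diff by blast
    then show ?thesis by simp
  next
    case 2
    \<comment> \<open>The two walks run towards each other and meet at a vertex or across an edge.\<close>
    define J where "J = j + \<bar>i - j\<bar> * N"
    have J1: "J - 1 = j - 1 + \<bar>i - j\<bar> * N" unfolding J_def by simp
    have per: "C J = C j" "c (J - 1) = c (j - 1)"
      unfolding J1 unfolding J_def using periodic_mult[of C N, OF wd(6)] periodic_mult[of c N, OF wd(7)] by blast+
    have ge: "J \<ge> i"
      using wd(1) mult_left_mono[of 1 N "\<bar>i - j\<bar>"] unfolding J_def by simp
    have b: "C (i + int n) = C (J - int n)" "c (i + int n) = c (J - 1 - int n)" for n
      using backward[of i J] per assms 2 by auto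
    show ?thesis
    proof (cases "even (J - i)")
      case True
      then obtain m where m: "J - i = 2 * m" by (elim evenE)
      then have "c (i + m) = c (i + m - 1)" using b(2)[of "nat m"] ge by (auto simp: algebra_simps)
      then show ?thesis using adjacent[of "i + m"] by simp
    next
      case False
      then obtain m where m: "J - i = 2 * m + 1" by (elim oddE)
      have Jm: "J - m = i + m + 1" "int (nat m) = m" using m ge by simp_all
      then have "C (i + m) = C (i + m + 1)" using b(1)[of "nat m"] unfolding Jm by simp
      then show ?thesis using C_step_neq[of "i + m"] by simp
    qed
  qed
qed

text \<open>\<open>off F r\<close>: \<open>F\<close> hangs off the cycle in a tree of forks, and \<open>r\<close> leads back.\<close>

inductive off :: "('a \<Rightarrow> 'a \<Rightarrow> int) \<Rightarrow> 'a \<Rightarrow> bool" where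
  base: "ascending V (C n) i \<Longrightarrow> off (mut i (C n)) i"
| step: "off F r \<Longrightarrow> i \<in> V \<Longrightarrow> i \<noteq> r \<Longrightarrow> off (mut i F) i"

lemma off_ascending:
  "off F r \<Longrightarrow> skew F \<and> (\<forall>j\<in>V - {r}. ascending V F j) \<and> (mut r F \<in> range C \<or> (\<exists>r'. off (mut r F) r'))"
proof (induction rule: off.induct)
  case (base n i)
  then show ?case using ascending_mut[OF wd(2) base V] mut_mut[OF wd(2), of i n] skew_mut[OF wd(2)] by auto
next
  case (step F r i)
  then have g: "ascending V F i" "skew F" by auto
  then show ?case using ascending_mut[OF g(2,1) V] mut_mut[OF g(2), of i] skew_mut[OF g(2)] step.hyps by auto
qed

lemma closed: 
  assumes "F \<in> range C \<or> (\<exists>r. off F r)" "i \<in> V" shows "mut i F \<in> range C \<or> (\<exists>r. off (mut i F) r)"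
  using assms(1)
proof
  assume "F \<in> range C"
  then obtain n where n: "F = C n" by blast
  consider "ascending V F i" | "i = c (n - 1)" | "i = c n" using ascending_iff[OF assms(2)] n by blast
  then show ?thesis
  proof cases
    case 1 then show ?thesis using off.base n by blast
  next
    case 2 then show ?thesis using walk_back[OF w, of "n - 1"] n by auto
  next
    case 3 then show ?thesis using wd(4)[of n] n by (metis rangeI)
  qed
next
  assume "\<exists>r. off F r"
  then obtain r where r: "off F r" by blast
  show ?thesis
  proof (cases "i = r")
    case True then show ?thesis using off_ascending[OF r] by blast
  next
    case False then show ?thesis using off.step[OF r assms(2)] by blast
  qed
qed

lemma closed_fold:
  "F \<in> range C \<or> (\<exists>r. off F r) \<Longrightarrow> set xs \<subseteq> V \<Longrightarrow> fold mut xs F \<in> range C \<or> (\<exists>r. off (fold mut xs F) r)"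
proof (induction xs arbitrary: F)
  case (Cons x xs)
  have "mut x F \<in> range C \<or> (\<exists>r. off (mut x F) r)" using Cons.prems by (intro closed) auto
  then show ?case using Cons.IH[of "mut x F"] Cons.prems(2) by simp
qed simp

lemma class_abundant:
  assumes "F \<in> range C \<or> (\<exists>r. off F r)" shows "\<exists>k. ascending V F k"
  using assms
proof
  assume "\<exists>r. off F r"
  then obtain r where "off F r" by blast
  then have "\<forall>j\<in>V - {r}. ascending V F j" using off_ascending by blast
  moreover have "V - {r} \<noteq> {}" using V card_mono[of "{r}" V] by auto
  ultimately show ?thesis by blast
qed (use ex_ascending in blast)

text \<open>Off the cycle only \<open>r\<close> fails to ascend, so a closed walk would have to
  enter and leave such a quiver by the same label.\<close>

lemma walk_in_range:
  assumes Q: "walk V Q y L" and "Q 0 \<in> range C \<or> (\<exists>r. off (Q 0) r)"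
  shows "Q n \<in> range C"
proof -
  note qd = walkD[OF Q]
  have K: "Q (int k) \<in> range C \<or> (\<exists>r. off (Q (int k)) r)" for k
  proof (induction k)
    case (Suc k)
    have "Q (int (Suc k)) = mut (y (int k)) (Q (int k))" using qd(4)[of "int k"] by (simp add: algebra_simps)
    then show ?case using closed[OF Suc qd(3)] by metis
  qed (use assms(2) in simp)
  have no: "\<not> off (Q n) r" for n r
  proof
    assume "off (Q n) r"
    then have g: "\<forall>j\<in>V - {r}. ascending V (Q n) j" using off_ascending by blast
    have "y n = r" using g walk_not_ascending[OF Q V, of n] qd(3)[of n] by blast
    moreover have "y (n - 1) = r" using g walk_not_ascending_back[OF Q V, of "n - 1"] qd(3)[of "n - 1"] by auto
    ultimately show False using qd(5)[of "n - 1"] by simp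
  qed
  \<comment> \<open>Adding enough periods makes the index nonnegative, where the forward induction
    applies.\<close>
  have "Q n = Q (n + \<bar>n\<bar> * L)" using periodic_mult[of Q L] qd(6) by metis
  moreover have "n + \<bar>n\<bar> * L \<ge> 0" using qd(1) mult_left_mono[of 1 L "\<bar>n\<bar>"] by linarith
  ultimately show ?thesis using K[of "nat (n + \<bar>n\<bar> * L)"] no by auto
qed

text \<open>At \<open>C m\<close> the label of a closed walk is one of the two labels of the cycle
  there. The first choice fixes the direction and reducedness keeps it. Backwards, the step leaving
  \<open>C (p - n)\<close> carries the label \<open>c (p - 1 - n)\<close>.\<close>

lemma walk_unique:
  assumes Q: "walk V Q y L" and K: "Q 0 \<in> range C \<or> (\<exists>r. off (Q 0) r)"
  shows "\<exists>p. (\<forall>n\<ge>0. Q n = C (p + n) \<and> y n = c (p + n)) \<or> (\<forall>n\<ge>0. Q n = C (p - n) \<and> y n = c (p - 1 - n))"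
proof -
  note qd = walkD[OF Q]
  obtain p where p: "Q 0 = C p" using walk_in_range[OF Q K] by blast
  have lab: "y n \<in> {c (m - 1), c m}" if "Q n = C m" for n m
    using walk_not_ascending[OF Q V, of n] ascending_iff[OF qd(3), of m n] that by auto
  consider "y 0 = c p" | "y 0 = c (p - 1)" using lab[OF p] by blast
  then show ?thesis
  proof cases
    case 1
    have "Q (int n) = C (p + int n) \<and> y (int n) = c (p + int n)" for n
    proof (induction n)
      case (Suc n)
      have 1: "Q (int n + 1) = C (p + int n + 1)" using Suc qd(4)[of "int n"] wd(4)[of "p + int n"] by simp
      have "y (int n + 1) = c (p + int n + 1)" using lab[OF 1] Suc qd(5)[of "int n"] by auto
      then show ?case using 1 by (simp add: algebra_simps)
    qed (use p 1 in simp)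
    then show ?thesis by (metis zero_le_imp_eq_int)
  next
    case 2
    have "Q (int n) = C (p - int n) \<and> y (int n) = c (p - 1 - int n)" for n
    proof (induction n)
      case (Suc n)
      have 1: "Q (int n + 1) = C (p - 1 - int n)"
        using Suc qd(4)[of "int n"] walk_back[OF w, of "p - 1 - int n"] by simp
      have "y (int n + 1) = c (p - 1 - int n - 1)" using lab[OF 1] Suc qd(5)[of "int n"] by auto
      then show ?case using 1 by (simp add: algebra_simps)
    qed (use p 2 in simp)
    then show ?thesis by (metis zero_le_imp_eq_int)
  qed
qed

end

section \<open>Label lists as periodic walks\<close>

definition list_walk :: "('a \<Rightarrow> 'a \<Rightarrow> int) \<Rightarrow> 'a list \<Rightarrow> int \<Rightarrow> 'a \<Rightarrow> 'a \<Rightarrow> int" where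
  "list_walk b xs n = fold mut (take (nat (n mod int (length xs))) xs) b"

definition list_label :: "'a list \<Rightarrow> int \<Rightarrow> 'a" where
  "list_label xs n = xs ! nat (n mod int (length xs))"

lemma mod_succ_cases:
  fixes n N :: int assumes "N > 0"
  obtains "n mod N + 1 < N" "(n + 1) mod N = n mod N + 1" | "n mod N + 1 = N" "(n + 1) mod N = 0"
proof -
  have b: "0 \<le> n mod N" "n mod N < N" using assms by simp_all
  have e: "(n + 1) mod N = (n mod N + 1) mod N" by (simp add: mod_add_left_eq)
  show ?thesis
  proof (cases "n mod N + 1 < N")
    case True then show ?thesis using that(1) e b by simp
  next
    case False
    then have "n mod N + 1 = N" using b by linarith
    then show ?thesis using that(2) e by simp
  qed
qed

lemma list_walk_step:
  assumes "xs \<noteq> []" "fold mut xs b = b"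
  shows "list_walk b xs (n + 1) = mut (list_label xs n) (list_walk b xs n)"
proof -
  let ?N = "int (length xs)"
  have N: "?N > 0" using assms by simp
  define m where "m = nat (n mod ?N)"
  have m: "int m = n mod ?N" "m < length xs" using N unfolding m_def by (simp_all add: nat_less_iff)
  have st: "fold mut (take (Suc m) xs) b = mut (xs ! m) (fold mut (take m xs) b)"
    by (simp add: take_Suc_conv_app_nth[OF m(2)])
  show ?thesis using N
  proof (cases rule: mod_succ_cases[of ?N n])
    case 1
    then have "nat ((n + 1) mod ?N) = Suc m" using m by linarith
    then show ?thesis using st unfolding list_walk_def list_label_def m_def[symmetric] by simp
  next
    case 2
    then have "Suc m = length xs" "(n + 1) mod ?N = 0" using m by linarith+
    then show ?thesis using st assms(2) unfolding list_walk_def list_label_def m_def[symmetric] by simp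
  qed
qed

lemma list_label_succ:
  assumes "distinct_adj xs" "length xs \<ge> 2" "last xs \<noteq> hd xs"
  shows "list_label xs n \<noteq> list_label xs (n + 1)"
proof -
  let ?N = "int (length xs)"
  have N: "?N > 0" using assms(2) by linarith
  define m where "m = nat (n mod ?N)"
  have m: "int m = n mod ?N" "m < length xs" using N unfolding m_def by (simp_all add: nat_less_iff)
  show ?thesis using N
  proof (cases rule: mod_succ_cases[of ?N n])
    case 1
    then have "nat ((n + 1) mod ?N) = Suc m" "Suc m < length xs" using m by linarith+
    then show ?thesis using assms(1) unfolding list_label_def m_def[symmetric] distinct_adj_conv_nth by simp
  next
    case 2
    then have e: "m = length xs - 1" "(n + 1) mod ?N = 0" using m by linarith+
    have "xs \<noteq> []" using N by auto
    then show ?thesis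
      using assms(3) e(2) unfolding list_label_def m_def[symmetric] e(1) by (simp add: last_conv_nth hd_conv_nth)
  qed
qed

lemma walk_of_list:
  assumes "skew b" "set xs \<subseteq> V" "fold mut xs b = b" "distinct_adj xs" "length xs \<ge> 2" "last xs \<noteq> hd xs"
  shows "walk V (list_walk b xs) (list_label xs) (int (length xs))"
proof -
  have ne: "xs \<noteq> []" using assms(5) by auto
  have "list_label xs n \<in> V" for n
    using assms(2) ne unfolding list_label_def by (auto simp: nat_less_iff intro!: subsetD[OF assms(2)] nth_mem)
  moreover have "skew (list_walk b xs n)" for n unfolding list_walk_def by (rule skew_fold_mut[OF assms(1)])
  ultimately show ?thesis
    unfolding walk_def using ne list_walk_step[OF ne assms(3)] list_label_succ[OF assms(4-6)]
    by (auto simp: list_walk_def list_label_def)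
qed

lemma tight_path_nth:
  "tight_path V b a xs \<Longrightarrow> n < length xs \<Longrightarrow> ascending_except V (fold mut (take n xs) b) ((a # xs) ! n) (xs ! n)"
proof (induction xs arbitrary: a b n)
  case (Cons x xs) then show ?case by (cases n) auto
qed simp

lemma tight_cycle_of_list:
  assumes "card V = 4" "skew b" "set (t # ys) \<subseteq> V" "fold mut (t # ys) b = b" "distinct_adj (t # ys)"
    "ys \<noteq> []" "t \<notin> set ys" and tight_path: "tight_path V b (last ys) (t # ys)"
  shows "tight_cycle V (list_walk b (t # ys)) (list_label (t # ys)) (int (length (t # ys))) t"
proof
  let ?xs = "t # ys" and ?N = "int (length (t # ys))"
  have N: "?N > 0" by simp
  have lst: "last ?xs = last ys" "last ?xs \<noteq> hd ?xs" using assms(6,7) last_in_set[OF assms(6)] by auto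
  have len: "length ?xs \<ge> 2" using assms(6) by (cases ys) auto
  show "card V = 4" by fact
  show "walk V (list_walk b ?xs) (list_label ?xs) ?N"
    by (rule walk_of_list[OF assms(2-5) len lst(2)])
  show "ascending_except V (list_walk b ?xs (n + 1)) (list_label ?xs n) (list_label ?xs (n + 1))" for n
  proof -
    define k where "k = nat ((n + 1) mod ?N)"
    have k: "int k = (n + 1) mod ?N" "k < length ?xs" using N unfolding k_def by (simp_all add: nat_less_iff del: length_Cons)
    \<comment> \<open>Putting the last label in front turns the cyclic predecessor into a plain
      index, also for \<open>k = 0\<close>.\<close>
    have "list_label ?xs n = (last ys # ?xs) ! k"
      using N
    proof (cases rule: mod_succ_cases[of ?N n])
      case 1
      have "0 \<le> n mod ?N" using N by simp
      then have "k = Suc (nat (n mod ?N))" using 1 k(1) by linarith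
      then show ?thesis unfolding list_label_def by simp
    next
      case 2
      then have "k = 0" "nat (n mod ?N) = length ?xs - 1" using k(1) by linarith+
      then show ?thesis unfolding list_label_def using last_conv_nth[of ?xs] lst(1) by simp
    qed
    then show ?thesis using tight_path_nth[OF tight_path k(2)] unfolding list_walk_def list_label_def k_def[symmetric] by metis
  qed
  show "list_label ?xs n = t \<longleftrightarrow> ?N dvd n" for n
  proof -
    define k where "k = nat (n mod ?N)"
    have k: "int k = n mod ?N" "k < length ?xs" using N unfolding k_def by (simp_all add: nat_less_iff del: length_Cons)
    have "?xs ! k = t \<longleftrightarrow> k = 0"
      using k(2) assms(7) by (cases k) auto
    moreover have "k = 0 \<longleftrightarrow> ?N dvd n" using k(1) by (metis dvd_eq_mod_eq_0 of_nat_eq_0_iff)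
    ultimately show ?thesis unfolding list_label_def k_def[symmetric] by blast
  qed
qed

definition simple_list :: "('a \<Rightarrow> 'a \<Rightarrow> int) \<Rightarrow> 'a list \<Rightarrow> bool" where
  "simple_list b xs \<longleftrightarrow> xs \<noteq> [] \<and> distinct_adj xs \<and> fold mut xs b = b \<and>
     distinct (map (\<lambda>k. fold mut (take k xs) b) [0..<length xs])"

text \<open>\<open>distinct_adj\<close> does not compare the last label with the first. If they
  agreed, the quivers after the first step and before the last one would coincide, against
  simplicity; for length 2 these are one and the same quiver, and reducedness decides. Length 1
  would need a mutation that fixes the matrix although it negates a nonzero entry.\<close>

lemma simple_list_last:
  assumes s: "simple_list b xs" and "skew b" and g: "ascending V b k" and xs: "set xs \<subseteq> V" and V: "card V = 4"
  shows "length xs \<ge> 2 \<and> last xs \<noteq> hd xs"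
proof -
  have s': "xs \<noteq> []" "distinct_adj xs" "fold mut xs b = b"
    "distinct (map (\<lambda>k. fold mut (take k xs) b) [0..<length xs])" using s unfolding simple_list_def by auto
  have len: "length xs \<ge> 2"
  proof (rule ccontr)
    assume "\<not> length xs \<ge> 2"
    then obtain x where x: "xs = [x]" using s'(1) by (cases xs; cases "tl xs") auto
    have "V - {x} \<noteq> {}" using V card_mono[of "{x}" V] by auto
    then obtain v where v: "v \<in> V" "v \<noteq> x" by blast
    have "mut x b x v = b x v" using s'(3) x by simp
    then have "b x v = 0" by (simp add: mut_def)
    then show False using ascending_abundant[OF g _ v(1), of x] v(2) xs x by auto
  qed
  moreover have "last xs \<noteq> hd xs"
  proof
    assume e: "last xs = hd xs"
    let ?n = "length xs - 1"
    have "fold mut xs b = mut (last xs) (fold mut (butlast xs) b)"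
      using s'(1) by (cases xs rule: rev_cases) auto
    then have "b = mut (hd xs) (fold mut (take ?n xs) b)"
      using s'(3) e by (simp add: butlast_conv_take)
    then have "fold mut (take ?n xs) b = mut (hd xs) b"
      using mut_mut[OF skew_fold_mut[OF assms(2)]] by metis
    also have "\<dots> = fold mut (take 1 xs) b" using s'(1) by (cases xs) auto
    finally have e2: "fold mut (take ?n xs) b = fold mut (take 1 xs) b" .
    show False
    proof (cases "length xs = 2")
      case True
      then obtain x y where "xs = [x, y]" by (auto simp: numeral_2_eq_2 length_Suc_conv)
      then show False using e s'(2) by simp
    next
      case False
      then have "?n \<noteq> 1" "?n < length xs" "1 < length xs" using len by auto
      then show False using e2 nth_eq_iff_index_eq[OF s'(4), of ?n 1] by auto
    qed
  qed
  ultimately show ?thesis ..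
qed

lemma list_walk_small: "n < length xs \<Longrightarrow> list_walk b xs (int n) = fold mut (take n xs) b"
  "n < length xs \<Longrightarrow> list_label xs (int n) = xs ! n"
  unfolding list_walk_def list_label_def by simp_all

lemma unique_cycle:
  assumes T: "tight_cycle V (list_walk b xs) (list_label xs) (int (length xs)) t"
    and b': "b' = fold mut zs b" "set zs \<subseteq> V" and ys: "simple_list b' ys" "set ys \<subseteq> V" and xs: "xs \<noteq> []" "skew b"
  shows "\<exists>k<length xs. b' = fold mut (take k xs) b \<and> (ys = rotate k xs \<or> ys = rev (rotate k xs))"
proof -
  interpret tight_cycle V "list_walk b xs" "list_label xs" "int (length xs)" t by (rule T)
  let ?C = "list_walk b xs" and ?c = "list_label xs" and ?N = "int (length xs)"
  have "b = ?C 0" unfolding list_walk_def by simp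
  then have "b \<in> range ?C \<or> (\<exists>r. off b r)" by (metis rangeI)
  then have K: "b' \<in> range ?C \<or> (\<exists>r. off b' r)" using closed_fold b' by blast
  obtain k where k: "ascending V b' k" using class_abundant[OF K] by blast
  have sk: "skew b'" unfolding b' by (rule skew_fold_mut[OF xs(2)])
  have s: "ys \<noteq> []" "distinct_adj ys" "fold mut ys b' = b'"
    "distinct (map (\<lambda>k. fold mut (take k ys) b') [0..<length ys])" using ys(1) unfolding simple_list_def by auto
  have l: "length ys \<ge> 2" "last ys \<noteq> hd ys" using simple_list_last[OF ys(1) sk k ys(2) V] by auto
  have W: "walk V (list_walk b' ys) (list_label ys) (int (length ys))"
    by (rule walk_of_list[OF sk ys(2) s(3,2) l])
  have z: "list_walk b' ys 0 = b'" unfolding list_walk_def by simp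
  have per: "?C (p + ?N) = ?C p" "?C (p - ?N) = ?C p" for p
    using wd(6)[of p] wd(6)[of "p - ?N"] by simp_all
  obtain p where p: "(\<forall>n\<ge>0. list_walk b' ys n = ?C (p + n) \<and> list_label ys n = ?c (p + n)) \<or>
      (\<forall>n\<ge>0. list_walk b' ys n = ?C (p - n) \<and> list_label ys n = ?c (p - 1 - n))"
    using walk_unique[OF W] K unfolding z by blast
  have C0: "b' = ?C p" using p z by (metis add.right_neutral diff_zero order_refl)
  have Lper: "list_walk b' ys (int (length ys)) = b'" unfolding list_walk_def by simp
  have "?C (p + int (length ys)) = ?C p \<or> ?C (p - int (length ys)) = ?C p"
    using p Lper C0 by (metis of_nat_0_le_iff)
  then have "?N dvd int (length ys)" using C_inj by fastforce
  then have ge: "length xs \<le> length ys" using s(1) by (simp add: dvd_imp_le)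
  \<comment> \<open>So far the walk might run round the cycle several times; simplicity allows one
    round.\<close>
  have len: "length ys = length xs"
  proof (rule ccontr)
    assume "length ys \<noteq> length xs"
    then have lt: "length xs < length ys" using ge by simp
    have "list_walk b' ys ?N = ?C p" using p per by (metis of_nat_0_le_iff)
    then have "fold mut (take (length xs) ys) b' = fold mut (take 0 ys) b'"
      using list_walk_small(1)[OF lt] C0 by simp
    then show False using nth_eq_iff_index_eq[OF s(4), of "length xs" 0] lt xs(1) s(1) by auto
  qed
  define j where "j = nat (p mod ?N)"
  have N: "?N > 0" using xs by simp
  have j: "int j = p mod ?N" "j < length xs" using N unfolding j_def by (simp_all add: nat_less_iff)
  have b'j: "b' = fold mut (take j xs) b" using C0 unfolding list_walk_def j_def .
  have "ys = rotate j xs \<or> ys = rev (rotate j xs)"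
    using p
  proof
    assume f: "\<forall>n\<ge>0. list_walk b' ys n = ?C (p + n) \<and> list_label ys n = ?c (p + n)"
    have "ys ! n = rotate j xs ! n" if n: "n < length ys" for n
    proof -
      have "ys ! n = ?c (p + int n)" using f list_walk_small(2)[OF n] by (metis of_nat_0_le_iff)
      also have "\<dots> = ?c (int (j + n))" using j(1) by (simp add: list_label_def mod_add_left_eq)
      also have "\<dots> = xs ! ((j + n) mod length xs)" unfolding list_label_def by (simp flip: of_nat_mod add: of_nat_add[symmetric] del: of_nat_add)
      also have "\<dots> = rotate j xs ! n" using n len by (simp add: nth_rotate)
      finally show ?thesis .
    qed
    then show ?thesis using len by (intro disjI1 nth_equalityI) auto
  next
    assume f: "\<forall>n\<ge>0. list_walk b' ys n = ?C (p - n) \<and> list_label ys n = ?c (p - 1 - n)"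
    have "ys ! n = rev (rotate j xs) ! n" if n: "n < length ys" for n
    proof -
      \<comment> \<open>Position \<open>n\<close> of the reversed list is position \<open>?m\<close>
        of the rotated one, and \<open>j + ?m\<close> is congruent to \<open>p - 1 - n\<close>
        modulo the length.\<close>
      let ?m = "length xs - Suc n"
      have "ys ! n = ?c (p - 1 - int n)" using f list_walk_small(2)[OF n] by (metis of_nat_0_le_iff)
      also have "\<dots> = ?c (int (j + ?m))"
      proof -
        have "int (j + ?m) = p mod ?N + (?N - 1 - int n)" using j(1) n len by (simp add: of_nat_diff)
        then have "int (j + ?m) mod ?N = (p + (?N - 1 - int n)) mod ?N" by (simp add: mod_add_left_eq)
        also have "\<dots> = (p - 1 - int n + ?N) mod ?N" by (simp add: algebra_simps)
        also have "\<dots> = (p - 1 - int n) mod ?N" by simp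
        finally show ?thesis unfolding list_label_def by simp
      qed
      also have "\<dots> = xs ! ((j + ?m) mod length xs)" unfolding list_label_def by (simp flip: of_nat_mod add: of_nat_add[symmetric] del: of_nat_add)
      also have "\<dots> = rotate j xs ! ?m" using n len by (simp add: nth_rotate)
      also have "\<dots> = rev (rotate j xs) ! n" using n len by (simp add: rev_nth)
      finally show ?thesis .
    qed
    then show ?thesis using len by (intro disjI2 nth_equalityI) auto
  qed
  then show ?thesis using b'j j(2) by blast
qed

lemma simple_list_tight:
  assumes T: "tight_cycle V (list_walk b xs) (list_label xs) (int (length xs)) t"
    and "xs \<noteq> []" "distinct_adj xs" "fold mut xs b = b"
  shows "simple_list b xs"
proof -
  interpret tight_cycle V "list_walk b xs" "list_label xs" "int (length xs)" t by (rule T)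
  have "inj_on (\<lambda>k. fold mut (take k xs) b) {0..<length xs}"
  proof (rule inj_onI)
    fix i j assume ij: "i \<in> {0..<length xs}" "j \<in> {0..<length xs}" "fold mut (take i xs) b = fold mut (take j xs) b"
    then have "list_walk b xs (int i) = list_walk b xs (int j)" by (simp add: list_walk_small)
    then have "int (length xs) dvd int i - int j" by (rule C_inj)
    moreover have "\<bar>int i - int j\<bar> < int (length xs)" using ij(1,2) by auto
    ultimately have "int i - int j = 0"
      using dvd_imp_le_int[of "int i - int j" "int (length xs)"] by linarith
    then show "i = j" by simp
  qed
  then show ?thesis using assms(2-4) unfolding simple_list_def by (simp add: distinct_map)
qed

section \<open>From matrices to quivers\<close>

lemma skew_b_entry: "skew (b_entry Q)"
  unfolding skew_def b_entry_def by simp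

lemma supported_b_entry: assumes "is_quiver Q" shows "supported (verts Q) (b_entry Q)"
proof -
  have a: "arrows Q u v = 0" if "u \<notin> verts Q \<or> v \<notin> verts Q" for u v
    using assms that unfolding is_quiver_def by blast
  have "b_entry Q u v = 0" if "u \<notin> verts Q \<or> v \<notin> verts Q" for u v
    using a[of u v] a[of v u] that unfolding b_entry_def by auto
  then show ?thesis unfolding supported_def by blast
qed

lemma arrows_eq_nat: assumes "is_quiver Q" shows "arrows Q u v = nat (b_entry Q u v)"
proof -
  have "arrows Q u v = 0 \<or> arrows Q v u = 0" using assms unfolding is_quiver_def by metis
  then show ?thesis unfolding b_entry_def by auto
qed

lemma quiver_eqI:
  assumes "is_quiver Q" "is_quiver Q'" "verts Q = verts Q'" "b_entry Q = b_entry Q'" shows "Q = Q'"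
proof -
  have "arrows Q = arrows Q'" using arrows_eq_nat[OF assms(1)] arrows_eq_nat[OF assms(2)] assms(4) by (intro ext) simp
  then show ?thesis using assms(3) by simp
qed

lemma is_quiver_mutate: assumes "is_quiver Q" "i \<in> verts Q" shows "is_quiver (mutate i Q)"
proof -
  have a: "u \<in> verts Q" "v \<in> verts Q" if "arrows Q u v > 0" for u v
    using assms(1) that unfolding is_quiver_def by blast+
  have "u \<in> verts Q \<and> v \<in> verts Q" if "premutate i Q u v > 0" for u v
    using that a assms(2) unfolding premutate_def by (fastforce split: if_splits)
  then have "\<forall>u v. premutate i Q u v - premutate i Q v u > 0 \<longrightarrow> u \<in> verts Q \<and> v \<in> verts Q"
    by (meson diff_le_self order_less_le_trans)
  then show ?thesis using assms(1) unfolding is_quiver_def mutate_def by auto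
qed

lemma b_entry_mutate: assumes "is_quiver Q" shows "b_entry (mutate i Q) = mut i (b_entry Q)"
proof (intro ext)
  fix u v
  let ?b = "b_entry Q"
  have s: "?b v u = - ?b u v" for u v unfolding b_entry_def by simp
  have e: "b_entry (mutate i Q) u v = int (premutate i Q u v) - int (premutate i Q v u)"
    unfolding b_entry_def mutate_def by simp
  show "b_entry (mutate i Q) u v = mut i ?b u v"
  proof (cases "u = i \<or> v = i")
    case True then show ?thesis unfolding e unfolding premutate_def mut_def b_entry_def by auto
  next
    case False
    have p: "int (arrows Q w x) = (if ?b w x > 0 then ?b w x else 0)" for w x
      unfolding arrows_eq_nat[OF assms, of w x] by simp
    have "b_entry (mutate i Q) u v = ?b u v + (int (arrows Q u i) * int (arrows Q i v) - int (arrows Q v i) * int (arrows Q i u))"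
      unfolding e premutate_def b_entry_def[of Q] using False by simp
    then show ?thesis
      unfolding p using False unfolding mut_def s[of i v] s[of u i] by auto
  qed
qed

lemma mutate_seq_props:
  assumes "is_quiver Q" "set xs \<subseteq> verts Q"
  shows "is_quiver (mutate_seq xs Q) \<and> verts (mutate_seq xs Q) = verts Q \<and>
    b_entry (mutate_seq xs Q) = fold mut xs (b_entry Q)"
  using assms
proof (induction xs arbitrary: Q)
  case (Cons x xs)
  have "is_quiver (mutate x Q)" using Cons.prems by (intro is_quiver_mutate) auto
  moreover have "verts (mutate x Q) = verts Q" unfolding mutate_def by simp
  ultimately show ?case
    using Cons.IH[of "mutate x Q"] Cons.prems b_entry_mutate[of Q x] unfolding mutate_seq_def by simp
qed (simp add: mutate_seq_def)

lemma mutate_seq_eq_iff: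
  assumes "is_quiver Q" "set xs \<subseteq> verts Q" "set ys \<subseteq> verts Q"
  shows "mutate_seq xs Q = mutate_seq ys Q \<longleftrightarrow> fold mut xs (b_entry Q) = fold mut ys (b_entry Q)"
  using mutate_seq_props[OF assms(1,2)] mutate_seq_props[OF assms(1,3)] quiver_eqI by metis

lemma simple_mutation_cycle_iff:
  assumes "is_quiver Q"
  shows "simple_mutation_cycle Q xs \<longleftrightarrow> set xs \<subseteq> verts Q \<and> simple_list (b_entry Q) xs"
proof (cases "set xs \<subseteq> verts Q")
  case True
  have t: "set (take k xs) \<subseteq> verts Q" for k using True set_take_subset by fastforce
  have "mutate_seq xs Q = Q \<longleftrightarrow> fold mut xs (b_entry Q) = b_entry Q"
    using mutate_seq_eq_iff[OF assms True, of "[]"] by (simp add: mutate_seq_def)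
  moreover have "distinct (map (\<lambda>k. mutate_seq (take k xs) Q) [0..<length xs]) \<longleftrightarrow>
      distinct (map (\<lambda>k. fold mut (take k xs) (b_entry Q)) [0..<length xs])"
    unfolding distinct_map inj_on_def using mutate_seq_eq_iff[OF assms t t] by simp
  ultimately show ?thesis
    using True unfolding simple_mutation_cycle_def mutation_cycle_def simple_list_def by auto
next
  case False
  then show ?thesis unfolding simple_mutation_cycle_def mutation_cycle_def by blast
qed

section \<open>Reddening source sequences\<close>

lemma untouched_frozen:
  assumes "j \<notin> set xs"
    and "\<And>i. i \<noteq> j \<Longrightarrow> arrows Q (Inl i) (Inr j) = 0 \<and> arrows Q (Inr j) (Inl i) = 0"
    and "arrows Q (Inl j) (Inr j) = 1" "arrows Q (Inr j) (Inl j) = 0"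
  shows "b_entry (mutate_seq (map Inl xs) Q) (Inl j) (Inr j) = 1"
  using assms
proof (induction xs arbitrary: Q)
  case Nil
  then show ?case by (simp add: mutate_seq_def b_entry_def)
next
  case (Cons x xs)
  have "b_entry (mutate_seq (map Inl xs) (mutate (Inl x) Q)) (Inl j) (Inr j) = 1"
  proof (rule Cons.IH)
    show "j \<notin> set xs" using Cons.prems(1) by simp
    show "arrows (mutate (Inl x) Q) (Inl i) (Inr j) = 0 \<and> arrows (mutate (Inl x) Q) (Inr j) (Inl i) = 0" if "i \<noteq> j" for i
      using Cons.prems that by (auto simp: mutate_def premutate_def)
    show "arrows (mutate (Inl x) Q) (Inl j) (Inr j) = 1" "arrows (mutate (Inl x) Q) (Inr j) (Inl j) = 0"
      using Cons.prems by (auto simp: mutate_def premutate_def)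
  qed
  then show ?case by (simp add: mutate_seq_def)
qed

text \<open>Until \<open>j\<close> is mutated, its frozen copy is adjacent to \<open>j\<close>
  alone, so no mutation elsewhere affects the arrow between them. An omitted vertex would keep the
  entry 1.\<close>

lemma reddening_seq_set: assumes "reddening_seq Q xs" shows "set xs = verts Q"
proof
  show "set xs \<subseteq> verts Q" using assms unfolding reddening_seq_def by blast
  show "verts Q \<subseteq> set xs"
  proof (rule subsetI, rule ccontr)
    fix j assume j: "j \<in> verts Q" "j \<notin> set xs"
    have "b_entry (mutate_seq (map Inl xs) (framed Q)) (Inl j) (Inr j) = 1"
      using j by (intro untouched_frozen) (auto simp: framed_def)
    then show False using assms j(1) unfolding reddening_seq_def by force
  qed
qed

lemma source_seq_order:
  assumes q: "is_quiver H" and ab: "abundant H" and c: "card (verts H) = 3"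
    and r: "reddening_source_seq H S" and d: "distinct_adj S"
  shows "\<exists>v1 v2 v3. S = [v1, v2, v3] \<and> distinct [v1, v2, v3] \<and> verts H = {v1, v2, v3} \<and>
    b_entry H v1 v2 \<ge> 2 \<and> b_entry H v2 v3 \<ge> 2 \<and> b_entry H v1 v3 \<ge> 2"
proof -
  have src: "i < j" if "i < length S" "j < length S" "arrows H (S ! i) (S ! j) > 0" for i j
    using r that unfolding reddening_source_seq_def source_seq_def by blast
  have S: "set S = verts H" using r reddening_seq_set unfolding reddening_source_seq_def by blast
  have b2: "b_entry H u v \<ge> 2 \<or> arrows H v u > 0" if "u \<in> set S" "v \<in> set S" "u \<noteq> v" for u v
  proof -
    have "\<bar>b_entry H u v\<bar> \<ge> 2" using ab that unfolding abundant_def S by blast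
    then show ?thesis unfolding b_entry_def by linarith
  qed
  have fwd: "b_entry H (S ! i) (S ! j) \<ge> 2" if "i < j" "j < length S" "S ! i \<noteq> S ! j" for i j
    using b2[of "S ! i" "S ! j"] src[of j i] that by fastforce
  have "distinct S"
  proof (rule ccontr)
    assume "\<not> distinct S"
    then obtain i j where ij: "i < j" "j < length S" "S ! i = S ! j"
      unfolding distinct_conv_nth by (metis linorder_neqE_nat)
    \<comment> \<open>By reducedness a different vertex stands between two occurrences of the same
      one; arrows only run forward in \<open>S\<close>, so it would be joined to that vertex in both
      directions.\<close>
    have "Suc i < length S" using ij by simp
    then have n: "S ! Suc i \<noteq> S ! i" using d unfolding distinct_adj_conv_nth by metis
    then have "Suc i < j" using ij by (metis Suc_lessI)
    then have "b_entry H (S ! i) (S ! Suc i) \<ge> 2" "b_entry H (S ! Suc i) (S ! j) \<ge> 2"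
      using fwd[of i "Suc i"] fwd[of "Suc i" j] ij n by auto
    then show False unfolding ij(3) b_entry_def by linarith
  qed
  then have "length S = 3" using S c distinct_card by metis
  then obtain v1 v2 v3 where v: "S = [v1, v2, v3]"
    by (auto simp: numeral_3_eq_3 length_Suc_conv)
  then have "b_entry H v1 v2 \<ge> 2" "b_entry H v2 v3 \<ge> 2" "b_entry H v1 v3 \<ge> 2"
    using fwd[of 0 1] fwd[of 1 2] fwd[of 0 2] \<open>distinct S\<close> by auto
  then show ?thesis using v S \<open>distinct S\<close> by auto
qed

section \<open>Acyclic quivers and the empty mutation sequence\<close>

lemma mut_source:
  assumes s: "skew b" and pos: "\<And>u. b a u \<ge> 0"
  shows "mut a b u v = (if u = a \<or> v = a then - b u v else b u v)"
  using pos[of u] pos[of v] skewD[OF s, of a u] unfolding mut_def by auto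

text \<open>Each vertex is a source when its turn comes, so mutation merely reverses its arrows.
  After all four turns every arrow has been reversed twice.\<close>

lemma acyclic_cycle:
  assumes s: "skew b" and V: "V = {a, c, d, e}" and dist: "distinct [a, c, d, e]" and sp: "supported V b"
    and b: "b a c \<ge> 2" "b a d \<ge> 2" "b a e \<ge> 2" "b c d \<ge> 2" "b c e \<ge> 2" "b d e \<ge> 2"
  shows "fold mut [a, c, d, e] b = b" "tight_path V b e [a, c, d, e]"
proof -
  define b1 where "b1 = mut a b"
  define b2 where "b2 = mut c b1"
  define b3 where "b3 = mut d b2"
  have sk: "skew b1" "skew b2" "skew b3" unfolding b1_def b2_def b3_def using s by (auto intro: skew_mut)
  have z: "b u v = 0" if "u \<notin> V \<or> v \<notin> V" for u v using sp that unfolding supported_def by blast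
  have n: "b c a = - b a c" "b d a = - b a d" "b e a = - b a e" "b d c = - b c d" "b e c = - b c e" "b e d = - b d e"
    by (rule skewD[OF s])+
  have dg: "b u u = 0" for u by (rule skew_diag[OF s])
  have p0: "b a u \<ge> 0" for u using b z[of a u] dg V by (cases "u \<in> V") auto
  have m1: "b1 u v = (if u = a \<or> v = a then - b u v else b u v)" for u v unfolding b1_def by (rule mut_source[OF s p0])
  have p1: "b1 c u \<ge> 0" for u unfolding m1 using dist b n z[of c u] dg V by (cases "u \<in> V") auto
  have m2: "b2 u v = (if u = c \<or> v = c then - b1 u v else b1 u v)" for u v
    unfolding b2_def by (rule mut_source[OF sk(1) p1])
  have p2: "b2 d u \<ge> 0" for u unfolding m2 m1 using dist b n z[of d u] dg V by (cases "u \<in> V") auto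
  have m3: "b3 u v = (if u = d \<or> v = d then - b2 u v else b2 u v)" for u v
    unfolding b3_def by (rule mut_source[OF sk(2) p2])
  have p3: "b3 e u \<ge> 0" for u unfolding m3 m2 m1 using dist b n z[of e u] dg V by (cases "u \<in> V") auto
  have m4: "mut e b3 u v = (if u = e \<or> v = e then - b3 u v else b3 u v)" for u v
    by (rule mut_source[OF sk(3) p3])
  have "mut e b3 u v = b u v" for u v
  proof (cases "u \<in> V \<and> v \<in> V")
    case True
    then show ?thesis unfolding m4 m3 m2 m1 V using dist dg by auto
  next
    case False
    then show ?thesis unfolding m4 m3 m2 m1 using z[of u v] by auto
  qed
  then show "fold mut [a, c, d, e] b = b" unfolding b3_def b2_def b1_def by (intro ext) simp
  have "ascending_except V b a e" using b by (intro ascending_except_acyclic[OF s V]) 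
  moreover have "ascending_except V b1 c a"
    using b n dist V by (intro ascending_except_acyclic[OF sk(1), of _ c d e a]) (auto simp: m1)
  moreover have "ascending_except V b2 d c"
    using b n dist V by (intro ascending_except_acyclic[OF sk(2), of _ d e a c]) (auto simp: m1 m2)
  moreover have "ascending_except V b3 e d"
    using b n dist V by (intro ascending_except_acyclic[OF sk(3), of _ e a c d]) (auto simp: m1 m2 m3)
  ultimately show "tight_path V b e [a, c, d, e]"
    using ascending_except_commute[of V] by (simp add: b1_def b2_def b3_def)
qed

lemma quiver_join_point:
  assumes q: "is_quiver K" and t: "t \<notin> verts K"
  shows "verts (quiver_join (point_quiver t) A K) = insert t (verts K)"
    "is_quiver (quiver_join (point_quiver t) A K)"
    "u \<in> verts K \<Longrightarrow> v \<in> verts K \<Longrightarrow> b_entry (quiver_join (point_quiver t) A K) u v = b_entry K u v"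
    "v \<in> verts K \<Longrightarrow> b_entry (quiver_join (point_quiver t) A K) t v = int (A t v)"
proof -
  have z: "arrows K u v = 0" if "u \<notin> verts K \<or> v \<notin> verts K" for u v
    using q that unfolding is_quiver_def by blast
  have o: "arrows K u v = 0 \<or> arrows K v u = 0" for u v using q unfolding is_quiver_def by metis
  have d: "arrows K u u = 0" for u using q unfolding is_quiver_def by metis
  have f: "finite (verts K)" using q unfolding is_quiver_def by metis
  have ar: "arrows (quiver_join (point_quiver t) A K) u v = arrows K u v + (if u = t \<and> v \<in> verts K then A u v else 0)" for u v
    unfolding quiver_join_def point_quiver_def by simp
  show V: "verts (quiver_join (point_quiver t) A K) = insert t (verts K)"
    unfolding quiver_join_def point_quiver_def by simp
  have "u = t \<or> u \<in> verts K" "v = t \<or> v \<in> verts K"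
    if "arrows K u v + (if u = t \<and> v \<in> verts K then A u v else 0) > 0" for u v
    using that z[of u v] by (auto split: if_splits)
  moreover have "arrows K u v + (if u = t \<and> v \<in> verts K then A u v else 0) = 0 \<or>
      arrows K v u + (if v = t \<and> u \<in> verts K then A v u else 0) = 0" for u v
    using o[of u v] z[of u v] z[of v u] t by auto
  ultimately show "is_quiver (quiver_join (point_quiver t) A K)"
    unfolding is_quiver_def V ar using f d t by auto
  show "b_entry (quiver_join (point_quiver t) A K) u v = b_entry K u v" if "u \<in> verts K" "v \<in> verts K"
    using that t unfolding b_entry_def ar by auto
  show "b_entry (quiver_join (point_quiver t) A K) t v = int (A t v)" if "v \<in> verts K"
    using that t z unfolding b_entry_def ar by auto
qed

theorem theorem4p27:
  fixes H :: "'a quiver" and S M :: "'a list" and four :: 'a and A :: "'a \<Rightarrow> 'a \<Rightarrow> nat"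
  assumes "is_quiver H" and "abundant H" and "acyclic_quiver H" and "card (verts H) = 3"
    and "reddening_source_seq H S"
    and "four \<notin> verts H"
    and "\<forall>h \<in> verts H. A four h \<ge> 2"
    and "set M \<subseteq> verts H"
    and "distinct_adj (rev M @ S @ M)"
  shows "unique_simple_mutation_cycle
           (quiver_join (point_quiver four) A (mutate_seq M H)) (four # rev M @ S @ M)"
proof -
  have dS: "distinct_adj S" "distinct_adj M" using assms(9) by (simp_all add: distinct_adj_append_iff)
  obtain v1 v2 v3 where S: "S = [v1, v2, v3]" and dv: "distinct [v1, v2, v3]"
    and VH: "verts H = {v1, v2, v3}"
    and bH: "b_entry H v1 v2 \<ge> 2" "b_entry H v2 v3 \<ge> 2" "b_entry H v1 v3 \<ge> 2"
    using source_seq_order[OF assms(1,2,4,5) dS(1)] by blast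
  define K where "K = mutate_seq M H"
  define Q where "Q = quiver_join (point_quiver four) A K"
  define V where "V = insert four (verts H)"
  define b where "b = b_entry Q"
  define xs where "xs = four # rev M @ [v1, v2, v3] @ M"
  have K: "is_quiver K" "verts K = verts H" "b_entry K = fold mut M (b_entry H)"
    using mutate_seq_props[OF assms(1,8)] unfolding K_def by auto
  have t: "four \<notin> verts K" using assms(6) K(2) by simp
  have VQ: "verts Q = V" and iQ: "is_quiver Q"
    using quiver_join_point(1,2)[OF K(1) t] unfolding Q_def V_def K(2) by auto
  have sb: "skew b" "supported V b" using skew_b_entry supported_b_entry[OF iQ] VQ unfolding b_def by auto
  have bK: "b u v = fold mut M (b_entry H) u v" if "u \<in> verts H" "v \<in> verts H" for u v
    using quiver_join_point(3)[OF K(1) t, of u v A] that unfolding b_def Q_def K(2,3) by simp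
  have b4: "b four h \<ge> 2" if "h \<in> verts H" for h
    using quiver_join_point(4)[OF K(1) t, of h A] assms(7) that unfolding b_def Q_def K(2) by simp
  have cV: "card V = 4" using assms(4,6) card.infinite[of "verts H"] unfolding V_def by (cases "finite (verts H)") auto
  have xsV: "set xs \<subseteq> V" using assms(8) VH unfolding xs_def V_def by auto
  have xs_ne: "rev M @ [v1, v2, v3] @ M \<noteq> []" by simp
  have four: "four \<notin> set (rev M @ [v1, v2, v3] @ M)" using assms(6,8) VH by auto
  have "four \<noteq> hd (rev M @ [v1, v2, v3] @ M)" using four hd_in_set[OF xs_ne] by metis
  then have dxs: "distinct_adj xs"
    using assms(9) unfolding xs_def S by (simp add: distinct_adj_Cons)
  have p0: "b four u \<ge> 0" for u
    using b4[of u] sb(2) skew_diag[OF sb(1), of four] unfolding supported_def V_def by (cases "u \<in> verts H"; cases "u = four") auto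
  have "fold mut xs b = b \<and> tight_path V b (last (rev M @ [v1, v2, v3] @ M)) xs"
  proof (cases "M = []")
    case True
    have V': "V = {four, v1, v2, v3}" unfolding V_def VH by blast
    have "distinct [four, v1, v2, v3]" using dv assms(6) VH by auto
    from acyclic_cycle[OF sb(1) V' this sb(2)] show ?thesis
      using b4 bK bH VH True unfolding xs_def by simp
  next
    case False
    \<comment> \<open>In the base quiver \<open>four\<close> is a source, so this mutation only
      negates its row and gives the other end of the two descents.\<close>
    define c where "c = mut four b"
    have c: "c u v = (if u = four \<or> v = four then - b u v else b u v)" for u v
      unfolding c_def by (rule mut_source[OF sb(1) p0])
    \<comment> \<open>\<open>rev M\<close> ends with \<open>hd M\<close>, so reducedness at the two
      junctions with \<open>S\<close> excludes \<open>v1\<close> and \<open>v3\<close>.\<close>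
    have hd: "hd M = v2"
    proof -
      have "hd M \<in> {v1, v2, v3}" using hd_in_set[OF False] assms(8) VH by blast
      moreover have "hd M \<noteq> v1" "hd M \<noteq> v3"
        using assms(9) False unfolding S by (auto simp: distinct_adj_append_iff last_rev distinct_adj_Cons)
      ultimately show ?thesis by blast
    qed
    interpret rank3_pair "b_entry H" v1 v2 v3 "verts H" M four c b V
    proof
      show "skew (b_entry H)" by (rule skew_b_entry)
      show "b_entry H v3 v1 \<le> - 2" using bH(3) skewD[OF skew_b_entry, of H v3 v1] by simp
      show "skew c" unfolding c_def by (rule skew_mut[OF sb(1)])
      show "\<forall>u\<in>verts H. \<forall>v\<in>verts H. c u v = fold mut M (b_entry H) u v"
        using bK c assms(6) by auto
      show "\<forall>h\<in>verts H. c h four \<ge> 2"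
        using b4 c skewD[OF sb(1), of four] by simp
      show "\<forall>h\<in>verts H. b h four = - c h four" using c by simp
    qed (use dv VH bH False dS assms(6,8) hd V_def sb bK in auto)
    have "supported V c" unfolding c_def by (rule supported_mut[OF sb(2)])
    from cycle[OF this sb(2) c_def[symmetric]] show ?thesis
      using False unfolding xs_def by simp
  qed
  then have cyc: "fold mut xs b = b" and tight_path: "tight_path V b (last (rev M @ [v1, v2, v3] @ M)) xs" by auto
  have T: "tight_cycle V (list_walk b xs) (list_label xs) (int (length xs)) four"
    unfolding xs_def
    by (rule tight_cycle_of_list[OF cV sb(1) xsV[unfolded xs_def] cyc[unfolded xs_def] dxs[unfolded xs_def]
          xs_ne four tight_path[unfolded xs_def]])
  have ne: "xs \<noteq> []" unfolding xs_def by simp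
  have 1: "simple_mutation_cycle Q xs"
    unfolding simple_mutation_cycle_iff[OF iQ] VQ
    using xsV simple_list_tight[OF T ne dxs cyc] unfolding b_def by blast
  have 2: "same_mutation_cycle Q xs Q' ys"
    if Q': "Q' \<in> mutation_class Q" and ys: "simple_mutation_cycle Q' ys" for Q' ys
  proof -
    obtain zs where zs: "Q' = mutate_seq zs Q" "set zs \<subseteq> V" using Q' VQ unfolding mutation_class_def by auto
    have q': "is_quiver Q'" "verts Q' = V" "b_entry Q' = fold mut zs b"
      using mutate_seq_props[OF iQ, of zs] zs VQ unfolding b_def by auto
    have ys': "set ys \<subseteq> V" "simple_list (b_entry Q') ys"
      using ys simple_mutation_cycle_iff[OF q'(1)] q'(2) by auto
    obtain k where k: "k < length xs" "b_entry Q' = fold mut (take k xs) b"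
        "ys = rotate k xs \<or> ys = rev (rotate k xs)"
      using unique_cycle[OF T q'(3) zs(2) ys'(2,1) ne sb(1)] by blast
    have tk: "set (take k xs) \<subseteq> verts Q" using xsV VQ set_take_subset[of k xs] by auto
    have "Q' = mutate_seq (take k xs) Q"
      using mutate_seq_eq_iff[OF iQ _ tk, of zs] zs VQ q'(3) k(2) unfolding b_def by simp
    then show ?thesis using k unfolding same_mutation_cycle_def by blast
  qed
  show ?thesis
    using 1 2 unfolding unique_simple_mutation_cycle_def Q_def K_def xs_def S by blast
qed

end
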